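(* Let $f:\mathcal X\to[0,1]$ be a model, $\mathcal G$ a finite collection of groups $g:\mathcal X\to\{0,1\}$, $q\in[0,1]$, $\delta\in(0,1)$, and suppose $\mathcal S$ is $\rho$-Lipschitz. For $\lambda\in\mathbb R^{\mathcal G}$ put $\hat f(x;\lambda)=f(x)+\sum_{g\in\mathcal G}\lambda_g\,g(x)$. Let $D=\{(x_i,y_i)\}_{i=1}^n$ be drawn i.i.d. from $\mathcal D$, and let $$\lambda^*\in\arg\min_{\lambda}\mathbb E_{(x,y)\sim\mathcal D}\big[L_q(\hat f(x;\lambda),s(x,y))\big],\qquad \lambda^*_D\in\arg\min_\lambda\frac1n\sum_{i=1}^nL_q(\hat f(x_i;\lambda),s(x_i,y_i))$$ (the parameters found by the algorithm BatchGCP on $\mathcal D$ and on $D$ respectively). Put $q'=\max(q,1-q)$, $b=\max\{1,\lceil\max(\|\lambda^*\|_2,\|\lambda^*_D\|_2)\rceil\}$, and $$\alpha'=24\,\rho\, b\, q'\sqrt{\frac{\ln\!\big(\tfrac{\pi^2b^2}{3\delta}\big)+|\mathcal G|\ln(1+2n)}{2n}}.$$ Then with probability at least $1-\delta$ over the draw of $D$, for every $g\in\mathcal G$, $$\Big|\Pr_{(x,y)\sim\mathcal D}\big[y\in\mathcal T^{\hat f(\cdot;\lambda^*_D)}(x)\mid g(x)=1\big]-q\Big|\le\sqrt{\frac{\alpha'}{\Pr_{(x,y)\sim\mathcal D}[g(x)=1]}},$$ where $\mathcal T^{\hat f(\cdot;\lambda^*_D)}(x)=\{y:s(x,y)\le\hat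 f(x;\lambda^*_D)\}$.
   Context: Setting. $\mathcal D$ is a probability distribution on $\mathcal X\times\mathcal Y$, and $s:\mathcal X\times\mathcal Y\to[0,1]$ is a nonconformity score. $\mathcal S$ denotes the induced joint distribution of $(x,s(x,y))$ on $\mathcal X\times[0,1]$, and $\mathcal S(x)$ the conditional distribution of the score given $x$; standing assumption: each $\mathcal S(x)$ has a continuous CDF. $\mathcal S$ is $\rho$-Lipschitz if for every $x\in\mathcal X$ and all $0\le\tau\le\tau'\le1$: $\Pr_{s\sim\mathcal S(x)}[s\le\tau']-\Pr_{s\sim\mathcal S(x)}[s\le\tau]\le\rho(\tau'-\tau)$. All functions are measurable (including the choice $D\mapsto\lambda^*_D$), and each group has positive probability. Pinball loss: $L_q(\tau,s)=(s-\tau)q\,\mathbf 1[s>\tau]+(\tau-s)(1-q)\,\mathbf 1[s\le\tau]$. *)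

theory Defs
  imports "HOL-Probability.Probability"
begin

definition pinball_loss :: "real \<Rightarrow> real \<Rightarrow> real \<Rightarrow> real" where
  "pinball_loss q \<tau> t = (t - \<tau>) * q * of_bool (t > \<tau>) + (\<tau> - t) * (1 - q) * of_bool (t \<le> \<tau>)"

definition score_distr ::
    "'x measure \<Rightarrow> ('x \<times> 'y) measure \<Rightarrow> ('x \<Rightarrow> 'y \<Rightarrow> real) \<Rightarrow> ('x \<times> real) measure" where
  "score_distr MX D s = distr D (MX \<Otimes>\<^sub>M borel) (\<lambda>(x, y). (x, s x y))"

(* K is a regular conditional distribution of the score given x: the kernel K disintegrates
   the joint law S of (x, score) over its marginal on MX. *)
definition is_cond_score_distr ::
    "'x measure \<Rightarrow> ('x \<times> real) measure \<Rightarrow> ('x \<Rightarrow> real measure) \<Rightarrow> bool" where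
  "is_cond_score_distr MX S K \<longleftrightarrow>
     K \<in> MX \<rightarrow>\<^sub>M prob_algebra borel \<and>
     (\<forall>x\<in>space MX. emeasure (K x) {0..1} = 1) \<and>
     (\<forall>A\<in>sets MX. \<forall>B\<in>sets borel.
        emeasure S (A \<times> B) = (\<integral>\<^sup>+x\<in>A. emeasure (K x) B \<partial>distr S MX fst))"

definition lipschitz_scores :: "'x measure \<Rightarrow> ('x \<Rightarrow> real measure) \<Rightarrow> real \<Rightarrow> bool" where
  "lipschitz_scores MX K \<rho> \<longleftrightarrow>
     (\<forall>x\<in>space MX. \<forall>\<tau> \<tau>'. 0 \<le> \<tau> \<and> \<tau> \<le> \<tau>' \<and> \<tau>' \<le> 1 \<longrightarrow>
        cdf (K x) \<tau>' - cdf (K x) \<tau> \<le> \<rho> * (\<tau>' - \<tau>))"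

(* The groups are themselves the coordinates of the parameter vector, so that the parameter
   space, real vectors indexed by G, is the extensional function space G \<rightarrow>\<^sub>E UNIV. *)
definition shifted_model ::
    "('x \<Rightarrow> real) \<Rightarrow> ('x \<Rightarrow> real) set \<Rightarrow> (('x \<Rightarrow> real) \<Rightarrow> real) \<Rightarrow> 'x \<Rightarrow> real" where
  "shifted_model f G \<theta> x = f x + (\<Sum>g\<in>G. \<theta> g * g x)"

definition population_loss ::
    "('x \<times> 'y) measure \<Rightarrow> ('x \<Rightarrow> 'y \<Rightarrow> real) \<Rightarrow> real \<Rightarrow> ('x \<Rightarrow> real) \<Rightarrow> ('x \<Rightarrow> real) set
      \<Rightarrow> (('x \<Rightarrow> real) \<Rightarrow> real) \<Rightarrow> real" where
  "population_loss D s q f G \<theta> =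
     (\<integral>(x, y). pinball_loss q (shifted_model f G \<theta> x) (s x y) \<partial>D)"

definition empirical_loss ::
    "nat \<Rightarrow> (nat \<Rightarrow> 'x \<times> 'y) \<Rightarrow> ('x \<Rightarrow> 'y \<Rightarrow> real) \<Rightarrow> real \<Rightarrow> ('x \<Rightarrow> real) \<Rightarrow> ('x \<Rightarrow> real) set
      \<Rightarrow> (('x \<Rightarrow> real) \<Rightarrow> real) \<Rightarrow> real" where
  "empirical_loss n d s q f G \<theta> =
     (1 / real n) * (\<Sum>i=1..n. case d i of (x, y) \<Rightarrow>
        pinball_loss q (shifted_model f G \<theta> x) (s x y))"

definition prediction_set ::
    "'y measure \<Rightarrow> ('x \<Rightarrow> 'y \<Rightarrow> real) \<Rightarrow> ('x \<Rightarrow> real) \<Rightarrow> 'x \<Rightarrow> 'y set" where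
  "prediction_set MY s h x = {y \<in> space MY. s x y \<le> h x}"

definition norm_bound ::
    "('x \<Rightarrow> real) set \<Rightarrow> (('x \<Rightarrow> real) \<Rightarrow> real) \<Rightarrow> (('x \<Rightarrow> real) \<Rightarrow> real) \<Rightarrow> real" where
  "norm_bound G \<theta> \<theta>' = max 1 (of_int \<lceil>max (L2_set \<theta> G) (L2_set \<theta>' G)\<rceil>)"

definition alpha_bound :: "real \<Rightarrow> real \<Rightarrow> real \<Rightarrow> real \<Rightarrow> nat \<Rightarrow> nat \<Rightarrow> real" where
  "alpha_bound \<rho> b q \<delta> m n =
     24 * \<rho> * b * max q (1 - q) *
       sqrt ((ln (pi\<^sup>2 * b\<^sup>2 / (3 * \<delta>)) + real m * ln (1 + 2 * real n)) / (2 * real n))"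

end

(* The coverage error is controlled directly, without passing through the losses. Optimality of
   the empirical minimizer in the direction of a group g says that the empirical mean of
   g(x) (1[s < h(x)] - q) is at most 0 and that of g(x) (1[s \<le> h(x)] - q) is at least 0, where h is
   the fitted model. In the population the two means agree, as the scores have no atoms, and
   equal P(g = 1) times the coverage error. They are compared by symmetrization with a ghost
   sample: the hyperplane arrangement of 2n points in the parameter space realizes at most
   (1 + 2n)^|G| threshold patterns. This gives P(g = 1) |error| \<le> 12 sqrt(C / 2n), where C is the
   numerator in alpha' for b = 1. As |error| \<le> 1, the same bound holds for P(g = 1) error^2, and
   rho \<ge> 1 because rho bounds the total mass of a conditional distribution. *)
theory Submission
  imports Defs
begin

text \<open>The fitted model depends on the sample, so its empirical mean is not an average of
  independent terms. The deviation bound concerns this one selected function instead of a supremum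
  over all parameters. Its exponential moment is dominated by a sum over the finitely many patterns
  on the double sample, so no supremum has to be measurable, only the choice
  \<open>\<theta>_emp\<close>. Two indicators, one strict and one not, are needed because sample
  points may lie exactly on the graph of the fitted model. Optimality then does not make the
  empirical error vanish, but it fixes the sign of each version, and this is the sign that a
  one-sided deviation bound requires. The number of such points never has to be estimated. The
  quantity alpha' depends on the sample through b. It increases with b, so a deterministic level,
  taken at b = 1, lies below it for every sample.\<close>

section \<open>Counting the threshold patterns of affine functions\<close>

text \<open>Deletion and restriction for hyperplane arrangements. A new hyperplane splits only
  patterns that are realized on it, and on it the other hyperplanes form an arrangement with one
  coordinate less. With k points and m coordinates the count obeys r(k + 1, m) \<le> r(k, m) + r(k,
  m - 1). Restriction changes \<open>G\<close>, \<open>c\<close> and \<open>v\<close>, so all three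
  are arbitrary in the induction.\<close>

lemma card_affine_threshold_patterns:
  fixes c :: "'i \<Rightarrow> real" and v :: "'i \<Rightarrow> 'a \<Rightarrow> real"
  assumes "finite I" "finite G"
  shows "card (range (\<lambda>\<theta>. {i\<in>I. c i \<le> (\<Sum>g\<in>G. \<theta> g * v i g)})) \<le> (1 + card I) ^ card G"
  using assms
proof (induction I arbitrary: G c v rule: finite_induct)
  case empty
  show ?case by simp
next
  case (insert j I)
  define P where "P = (\<lambda>\<theta>. {i\<in>I. c i \<le> (\<Sum>g\<in>G. \<theta> g * v i g)})"
  define Q where "Q = (\<lambda>\<theta>. {i\<in>insert j I. c i \<le> (\<Sum>g\<in>G. \<theta> g * v i g)})"
  define A0 where "A0 = {p\<in>range Q. j \<notin> p}"
  define A1 where "A1 = {p\<in>range Q. j \<in> p}"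
  define B where "B = (\<lambda>p. p - {j}) ` A1"
  have QP: "Q \<theta> - {j} = P \<theta>" for \<theta>
    using insert.hyps unfolding P_def Q_def by auto
  have finQ: "finite (range Q)"
    by (rule finite_subset[of _ "Pow (insert j I)"]) (auto simp: Q_def insert.hyps)
  have finP: "finite (range P)"
    by (rule finite_subset[of _ "Pow I"]) (auto simp: P_def insert.hyps)
  have fin: "finite A0" "finite A1" "finite B"
    using finQ unfolding A0_def A1_def B_def by auto
  have "card (range Q) = card (A0 \<union> A1)"
    by (rule arg_cong[where f = card]) (auto simp: A0_def A1_def)
  also have "\<dots> = card A0 + card A1"
    using fin by (intro card_Un_disjoint) (auto simp: A0_def A1_def)
  also have "card A1 = card B"
    unfolding B_def by (rule card_image[symmetric]) (auto simp: inj_on_def A1_def)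
  \<comment> \<open>After removal of \<open>j\<close>, the union collects patterns on
    \<open>I\<close>, and the intersection those that extend both with and without
    \<open>j\<close>.\<close>
  also have "card A0 + card B = card (A0 \<union> B) + card (A0 \<inter> B)"
    using fin by (intro card_Un_Int)
  finally have split: "card (range Q) = card (A0 \<union> B) + card (A0 \<inter> B)" .
  have "A0 \<union> B \<subseteq> range P"
  proof -
    have "p \<in> range P" if p: "p \<in> A0" for p
    proof -
      from p obtain \<theta> where "p = Q \<theta>" "j \<notin> p" unfolding A0_def by auto
      then have "p = P \<theta>" using QP[of \<theta>] by auto
      then show ?thesis by auto
    qed
    moreover have "p \<in> range P" if "p \<in> B" for p
      using that QP unfolding B_def A1_def by auto
    ultimately show ?thesis by auto
  qed
  then have "card (A0 \<union> B) \<le> card (range P)"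
    using finP by (intro card_mono)
  also have "\<dots> \<le> (1 + card I) ^ card G"
    unfolding P_def by (rule insert.IH) (rule insert.prems)
  finally have bound1: "card (A0 \<union> B) \<le> (1 + card I) ^ card G" .
  show ?case
  proof (cases "A0 \<inter> B = {}")
    case True
    have "card (range Q) \<le> (1 + card I) ^ card G"
      using split True bound1 by simp
    also have "\<dots> \<le> (1 + card (insert j I)) ^ card G"
      using insert.hyps by (intro power_mono) auto
    finally show ?thesis unfolding Q_def .
  next
    case False
    \<comment> \<open>A pattern that extends both ways is attained on the hyperplane through the new point,
      by an intermediate point of a segment: the cells are convex.\<close>
    have mid: "\<exists>\<theta>. p = P \<theta> \<and> (\<Sum>g\<in>G. \<theta> g * v j g) = c j \<and> (\<exists>g\<in>G. v j g \<noteq> 0)"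
      if p: "p \<in> A0 \<inter> B" for p
    proof -
      from p obtain \<alpha> where \<alpha>: "p = Q \<alpha>" "j \<notin> Q \<alpha>" unfolding A0_def by auto
      from p obtain \<beta> where \<beta>: "p = Q \<beta> - {j}" "j \<in> Q \<beta>" unfolding A1_def B_def by auto
      have pP: "p = P \<alpha>" "p = P \<beta>" using \<alpha> \<beta> QP by auto
      define a where "a = (\<lambda>i. \<Sum>g\<in>G. \<alpha> g * v i g)"
      define b where "b = (\<lambda>i. \<Sum>g\<in>G. \<beta> g * v i g)"
      have aj: "a j < c j" using \<alpha>(2) unfolding Q_def a_def by auto
      have bj: "c j \<le> b j" using \<beta>(2) unfolding Q_def b_def by auto
      \<comment> \<open>The parameter at which the segment from \<alpha> to \<beta> meets the
        hyperplane of \<open>j\<close>; \<open>aj\<close> and \<open>bj\<close> make the denominator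
        positive and place \<open>u\<close> in the unit interval.\<close>
      define u where "u = (c j - a j) / (b j - a j)"
      have u: "0 \<le> u" "u \<le> 1" using aj bj unfolding u_def by (auto simp: field_simps)
      define \<gamma> where "\<gamma> = (\<lambda>g. (1 - u) * \<alpha> g + u * \<beta> g)"
      have \<gamma>: "(\<Sum>g\<in>G. \<gamma> g * v i g) = (1 - u) * a i + u * b i" for i
        unfolding \<gamma>_def a_def b_def
        by (simp add: sum_distrib_left sum.distrib[symmetric] algebra_simps)
      have "u * (b j - a j) = c j - a j" using aj bj unfolding u_def by simp
      then have 1: "(\<Sum>g\<in>G. \<gamma> g * v j g) = c j"
        unfolding \<gamma> by (simp add: algebra_simps)
      have 2: "\<exists>g\<in>G. v j g \<noteq> 0"
      proof (rule ccontr)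
        assume "\<not> ?thesis"
        then have "a j = 0" "b j = 0" unfolding a_def b_def by auto
        then show False using aj bj by simp
      qed
      have 3: "c i \<le> (\<Sum>g\<in>G. \<gamma> g * v i g) \<longleftrightarrow> i \<in> p" if i: "i \<in> I" for i
      proof (cases "i \<in> p")
        case True
        then have "c i \<le> a i" "c i \<le> b i" using pP unfolding P_def a_def b_def by auto
        then have "(1 - u) * c i + u * c i \<le> (1 - u) * a i + u * b i"
          using u by (intro add_mono mult_left_mono) auto
        moreover have "(1 - u) * c i + u * c i = c i" by (simp add: algebra_simps)
        ultimately show ?thesis using True \<gamma>[of i] by simp
      next
        case False
        then have *: "a i < c i" "b i < c i" using pP i unfolding P_def a_def b_def by force+
        have "(1 - u) * a i + u * b i < c i"
          using convex_bound_lt[OF * , of "1 - u" u] u by simp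
        then show ?thesis using False \<gamma> by simp
      qed
      have "p \<subseteq> I" using pP unfolding P_def by auto
      then have "p = P \<gamma>" using 3 unfolding P_def by auto
      then show ?thesis using 1 2 by blast
    qed
    then obtain h where h: "h \<in> G" "v j h \<noteq> 0" using False by blast
    \<comment> \<open>Gaussian elimination: the equation of the hyperplane of \<open>j\<close>,
      scaled by \<open>r i\<close>, is subtracted from row \<open>i\<close>. This makes
      \<open>v' i h\<close> zero, so that on the hyperplane the coordinate \<open>h\<close> drops
      out.\<close>
    define r where "r = (\<lambda>i. v i h / v j h)"
    define c' where "c' = (\<lambda>i. c i - c j * r i)"
    define v' where "v' = (\<lambda>i g. v i g - v j g * r i)"
    have "A0 \<inter> B \<subseteq> range (\<lambda>\<theta>. {i\<in>I. c' i \<le> (\<Sum>g\<in>G - {h}. \<theta> g * v' i g)})"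
    proof
      fix p assume "p \<in> A0 \<inter> B"
      from mid[OF this] obtain \<theta> where \<theta>: "p = P \<theta>" "(\<Sum>g\<in>G. \<theta> g * v j g) = c j" by blast
      have "(\<Sum>g\<in>G - {h}. \<theta> g * v' i g) = (\<Sum>g\<in>G. \<theta> g * v i g) - c j * r i" for i
      proof -
        have "(\<Sum>g\<in>G. \<theta> g * v' i g) = \<theta> h * v' i h + (\<Sum>g\<in>G - {h}. \<theta> g * v' i g)"
          by (rule sum.remove) (use h insert.prems in auto)
        moreover have "v' i h = 0" using h unfolding v'_def r_def by simp
        moreover have "(\<Sum>g\<in>G. \<theta> g * v' i g) = (\<Sum>g\<in>G. \<theta> g * v i g) - (\<Sum>g\<in>G. \<theta> g * v j g) * r i"
          unfolding v'_def by (simp add: sum_distrib_right right_diff_distrib sum_subtractf mult.assoc)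
        ultimately show ?thesis using \<theta> by simp
      qed
      then have "p = {i\<in>I. c' i \<le> (\<Sum>g\<in>G - {h}. \<theta> g * v' i g)}"
        unfolding \<theta>(1) P_def c'_def by auto
      then show "p \<in> range (\<lambda>\<theta>. {i\<in>I. c' i \<le> (\<Sum>g\<in>G - {h}. \<theta> g * v' i g)})" by blast
    qed
    moreover have "finite (range (\<lambda>\<theta>. {i\<in>I. c' i \<le> (\<Sum>g\<in>G - {h}. \<theta> g * v' i g)}))"
      by (rule finite_subset[of _ "Pow I"]) (auto simp: insert.hyps)
    ultimately have "card (A0 \<inter> B) \<le> card (range (\<lambda>\<theta>. {i\<in>I. c' i \<le> (\<Sum>g\<in>G - {h}. \<theta> g * v' i g)}))"
      by (intro card_mono)
    also have "\<dots> \<le> (1 + card I) ^ card (G - {h})"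
      by (rule insert.IH) (use insert.prems in auto)
    finally have bound2: "card (A0 \<inter> B) \<le> (1 + card I) ^ card (G - {h})" .
    have cG: "card G = Suc (card (G - {h}))"
      using h insert.prems by (metis card.remove)
    have "card (range Q) \<le> (2 + card I) * (1 + card I) ^ card (G - {h})"
      using split bound1 bound2 unfolding cG by simp
    also have "\<dots> \<le> (2 + card I) * (2 + card I) ^ card (G - {h})"
      by (intro mult_left_mono power_mono) auto
    also have "\<dots> = (1 + card (insert j I)) ^ card G"
      using insert.hyps unfolding cG by simp
    finally show ?thesis unfolding Q_def .
  qed
qed

section \<open>Exponential moments of random signs\<close>

text \<open>Hoeffding's lemma for a fair coin with values \<open>- x\<close> and \<open>x\<close>.
  The auxiliary inequality is used at \<open>2 * x\<close> with probability 1/2 for nonnegative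
  \<open>x\<close>; the left side is even, which covers the other sign.\<close>

lemma exp_minus_add_exp_le:
  fixes x :: real
  shows "exp (- x) + exp x \<le> 2 * exp (x\<^sup>2 / 2)"
proof -
  have *: "exp (- x) + exp x \<le> 2 * exp (x\<^sup>2 / 2)" if "x \<ge> 0" for x :: real
  proof -
    have "- x + ln ((1 + exp (2 * x)) / 2) \<le> x\<^sup>2 / 2"
      using Hoeffdings_lemma_aux[of "2 * x" "1 / 2"] that
      by (simp add: field_simps power2_eq_square)
    then have le: "exp (- x + ln ((1 + exp (2 * x)) / 2)) \<le> exp (x\<^sup>2 / 2)"
      by simp
    have "exp (- x + ln ((1 + exp (2 * x)) / 2)) = exp (- x) * ((1 + exp (2 * x)) / 2)"
      by (simp only: exp_add) (simp add: add_pos_pos)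
    also have "\<dots> = (exp (- x) + exp x) / 2"
      by (simp add: distrib_left flip: exp_add)
    finally show ?thesis
      using le by (simp only:) simp
  qed
  show ?thesis
    using *[of x] *[of "- x"] by (cases "x \<ge> 0") (auto simp: add.commute)
qed

text \<open>Independence of the signs: the sum over all sign vectors factors into a product over the
  coordinates. A sign vector is encoded as the set \<sigma> of its negative coordinates, and
  \<open>2 ^ card I\<close> is the number of sign vectors, so the inequality is a bound on an
  expectation.\<close>

lemma rademacher_exp_sum_le:
  fixes a :: "'i \<Rightarrow> real"
  assumes "finite I"
  shows "(\<Sum>\<sigma>\<in>Pow I. exp (\<Sum>i\<in>I. if i \<in> \<sigma> then - a i else a i))
           \<le> 2 ^ card I * exp ((\<Sum>i\<in>I. (a i)\<^sup>2) / 2)"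
proof -
  have "(\<Sum>\<sigma>\<in>Pow I. exp (\<Sum>i\<in>I. if i \<in> \<sigma> then - a i else a i))
      = (\<Sum>\<sigma>\<in>Pow I. (\<Prod>i\<in>\<sigma>. exp (- a i)) * (\<Prod>i\<in>I - \<sigma>. exp (a i)))"
  proof (rule sum.cong[OF refl])
    fix \<sigma> assume \<sigma>: "\<sigma> \<in> Pow I"
    have "exp (\<Sum>i\<in>I. if i \<in> \<sigma> then - a i else a i) = (\<Prod>i\<in>I. exp (if i \<in> \<sigma> then - a i else a i))"
      using assms by (rule exp_sum)
    also have "\<dots> = (\<Prod>i\<in>I - \<sigma>. exp (if i \<in> \<sigma> then - a i else a i)) *
        (\<Prod>i\<in>\<sigma>. exp (if i \<in> \<sigma> then - a i else a i))"
      using \<sigma> assms by (intro prod.subset_diff) auto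
    also have "\<dots> = (\<Prod>i\<in>\<sigma>. exp (- a i)) * (\<Prod>i\<in>I - \<sigma>. exp (a i))"
      by simp
    finally show "exp (\<Sum>i\<in>I. if i \<in> \<sigma> then - a i else a i) =
      (\<Prod>i\<in>\<sigma>. exp (- a i)) * (\<Prod>i\<in>I - \<sigma>. exp (a i))" .
  qed
  also have "\<dots> = (\<Prod>i\<in>I. exp (- a i) + exp (a i))"
    using assms by (rule prod_add[symmetric])
  also have "\<dots> \<le> (\<Prod>i\<in>I. 2 * exp ((a i)\<^sup>2 / 2))"
    by (intro prod_mono) (auto simp: exp_minus_add_exp_le add_nonneg_nonneg)
  also have "\<dots> = 2 ^ card I * exp ((\<Sum>i\<in>I. (a i)\<^sup>2) / 2)"
    using assms by (simp add: prod.distrib exp_sum[symmetric] sum_divide_distrib)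
  finally show ?thesis .
qed

section \<open>Deviation bound for a function selected by the sample\<close>

text \<open>\<open>H d\<close> is the function selected by the sample \<open>d\<close>. Jensen's
  inequality replaces its mean under \<open>D\<close> by the empirical mean over a ghost sample,
  placed at the indices above \<open>n\<close>. Averaging over all exchanges of points between the
  halves produces random signs for each fixed pattern. In the exponent, n squared differences of
  size at most t^2 / n^2 add up to t^2 / n, and the bound for random signs halves this.\<close>

lemma symmetrization_mgf:
  fixes D :: "'z measure" and H :: "(nat \<Rightarrow> 'z) \<Rightarrow> 'z \<Rightarrow> real" and lo t :: real
  assumes D: "prob_space D" and n: "n \<ge> 1"
    and H: "(\<lambda>(d, z). H d z) \<in> borel_measurable ((\<Pi>\<^sub>M i\<in>{1..n}. D) \<Otimes>\<^sub>M D)"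
    and range: "\<And>d z. d \<in> space (\<Pi>\<^sub>M i\<in>{1..n}. D) \<Longrightarrow> z \<in> space D \<Longrightarrow> H d z \<in> {lo..lo + 1}"
    and patterns: "\<And>\<omega>. \<omega> \<in> {1..2 * n} \<rightarrow> space D \<Longrightarrow>
        finite ((\<lambda>d. \<lambda>i\<in>{1..2 * n}. H d (\<omega> i)) ` space (\<Pi>\<^sub>M i\<in>{1..n}. D)) \<and>
        card ((\<lambda>d. \<lambda>i\<in>{1..2 * n}. H d (\<omega> i)) ` space (\<Pi>\<^sub>M i\<in>{1..n}. D)) \<le> N"
  shows "(\<integral>\<^sup>+ d. ennreal (exp (t * ((\<integral>z. H d z \<partial>D) - (\<Sum>i=1..n. H d (d i)) / n)))
            \<partial>(\<Pi>\<^sub>M i\<in>{1..n}. D)) \<le> ennreal (N * exp (t\<^sup>2 / (2 * real n)))"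
proof -
  note One_nat_def[simp del]
  interpret D: prob_space D by fact
  let ?I = "{1..n}" and ?J = "{n<..2 * n}" and ?K = "{1..2 * n}"
  let ?DI = "\<Pi>\<^sub>M i\<in>?I. D" and ?DJ = "\<Pi>\<^sub>M i\<in>?J. D" and ?DK = "\<Pi>\<^sub>M i\<in>?K. D"
  interpret DJ: prob_space ?DJ by (intro prob_space_PiM D)
  interpret P: product_prob_space "\<lambda>_ :: nat. D" ?J by standard
  interpret DK: prob_space ?DK by (intro prob_space_PiM D)
  have IJ: "?I \<union> ?J = ?K" "?I \<inter> ?J = {}" using n by auto
  have Hd: "(\<lambda>z. H d z) \<in> borel_measurable D" if "d \<in> space ?DI" for d
    using measurable_compose[OF measurable_Pair1'[OF that] H] by simp
  \<comment> \<open>The ghost mean takes the place of the population mean, while the function is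
    still selected by the first half of the double sample alone.\<close>
  define \<Psi> where "\<Psi> = (\<lambda>\<omega>. exp (t / n *
      (\<Sum>i=1..n. H (restrict \<omega> ?I) (\<omega> (n + i)) - H (restrict \<omega> ?I) (\<omega> i))))"
  have comp: "(\<lambda>\<omega>. H (restrict \<omega> ?I) (\<omega> j)) \<in> borel_measurable ?DK" if "j \<in> ?K" for j
  proof -
    have "(\<lambda>\<omega>. restrict \<omega> ?I) \<in> ?DK \<rightarrow>\<^sub>M ?DI"
      by (rule measurable_restrict_subset) auto
    moreover have "(\<lambda>\<omega>. \<omega> j) \<in> ?DK \<rightarrow>\<^sub>M D"
      using that by (rule measurable_component_singleton)
    ultimately show ?thesis
      using measurable_compose[OF measurable_Pair H, of "\<lambda>\<omega>. restrict \<omega> ?I" ?DK "\<lambda>\<omega>. \<omega> j"] by simp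
  qed
  have \<Psi>[measurable]: "\<Psi> \<in> borel_measurable ?DK"
    unfolding \<Psi>_def
    by (rule measurable_compose[OF _ borel_measurable_exp], intro borel_measurable_times
        borel_measurable_const borel_measurable_sum borel_measurable_diff comp) auto

  have "(\<integral>\<^sup>+ d. ennreal (exp (t * ((\<integral>z. H d z \<partial>D) - (\<Sum>i=1..n. H d (d i)) / n))) \<partial>?DI)
      \<le> (\<integral>\<^sup>+ \<omega>. ennreal (\<Psi> \<omega>) \<partial>?DK)"
  proof -
    have "(\<integral>\<^sup>+ \<omega>. ennreal (\<Psi> \<omega>) \<partial>?DK) =
        (\<integral>\<^sup>+ x. (\<integral>\<^sup>+ y. ennreal (\<Psi> (merge ?I ?J (x, y))) \<partial>?DJ) \<partial>?DI)"
      by (rule P.product_nn_integral_fold[of ?I ?J "\<lambda>\<omega>. ennreal (\<Psi> \<omega>)", unfolded IJ(1)])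
        (rule IJ, simp, simp, measurable)
    moreover have "ennreal (exp (t * ((\<integral>z. H x z \<partial>D) - (\<Sum>i=1..n. H x (x i)) / n)))
        \<le> (\<integral>\<^sup>+ y. ennreal (\<Psi> (merge ?I ?J (x, y))) \<partial>?DJ)" if x: "x \<in> space ?DI" for x
    proof -
      define m where "m = t * ((\<integral>z. H x z \<partial>D) - (\<Sum>i=1..n. H x (x i)) / n)"
      define Z where "Z = (\<lambda>y. t / n * (\<Sum>i=1..n. H x (y (n + i)) - H x (x i)))"
      have xi: "x i \<in> space D" if "i \<in> ?I" for i
        using x that by (auto simp: space_PiM)
      have \<Psi>Z: "\<Psi> (merge ?I ?J (x, y)) = exp (Z y)" for y
      proof -
        have "restrict (merge ?I ?J (x, y)) ?I = x"
          using x by (auto simp: space_PiM merge_def restrict_def PiE_def extensional_def)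
        moreover have "merge ?I ?J (x, y) (n + i) = y (n + i)" "merge ?I ?J (x, y) i = x i"
          if "i \<in> ?I" for i
          using that by (auto simp: merge_def)
        ultimately show ?thesis
          unfolding \<Psi>_def Z_def by simp
      qed
      have comp_int: "(\<integral>y. H x (y j) \<partial>?DJ) = (\<integral>z. H x z \<partial>D)" if j: "j \<in> ?J" for j
      proof -
        have "(\<integral>z. H x z \<partial>(distr ?DJ D (\<lambda>y. y j))) = (\<integral>y. H x (y j) \<partial>?DJ)"
          using measurable_component_singleton[OF j, of "\<lambda>_. D"] Hd[OF x] by (rule integral_distr)
        then show ?thesis using P.PiM_component[OF j] by simp
      qed
      have comp_m: "(\<lambda>y. H x (y j)) \<in> borel_measurable ?DJ" if j: "j \<in> ?J" for j
        using measurable_compose[OF measurable_component_singleton[OF j] Hd[OF x]] .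
      have comp_i: "integrable ?DJ (\<lambda>y. H x (y j))" if j: "j \<in> ?J" for j
      proof (rule DJ.integrable_const_bound[where B = "\<bar>lo\<bar> + 1"])
        show "AE y in ?DJ. norm (H x (y j)) \<le> \<bar>lo\<bar> + 1"
        proof (rule AE_I2)
          fix y assume "y \<in> space ?DJ"
          then have "y j \<in> space D" using j by (auto simp: space_PiM)
          from range[OF x this] show "norm (H x (y j)) \<le> \<bar>lo\<bar> + 1" by auto
        qed
      qed (rule comp_m[OF j])
      have Zi: "integrable ?DJ Z"
        unfolding Z_def
        by (intro integrable_mult_right Bochner_Integration.integrable_sum
            Bochner_Integration.integrable_diff comp_i integrable_const) (auto simp: DJ.emeasure_space_1)
      have "(\<integral>y. Z y \<partial>?DJ) = t / n * (\<Sum>i=1..n. (\<integral>y. H x (y (n + i)) - H x (x i) \<partial>?DJ))"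
        unfolding Z_def
        by (subst integral_mult_right_zero, subst Bochner_Integration.integral_sum)
          (auto intro!: Bochner_Integration.integrable_diff comp_i)
      also have "\<dots> = t / n * (\<Sum>i=1..n. (\<integral>z. H x z \<partial>D) - H x (x i))"
      proof -
        have "(\<integral>y. H x (y (n + i)) - H x (x i) \<partial>?DJ) = (\<integral>z. H x z \<partial>D) - H x (x i)"
          if "i \<in> ?I" for i
          using that by (subst Bochner_Integration.integral_diff)
            (auto intro!: comp_i simp: comp_int DJ.prob_space)
        then show ?thesis by simp
      qed
      also have "\<dots> = m"
        using n unfolding m_def by (simp add: sum_subtractf field_simps)
      finally have Zm: "(\<integral>y. Z y \<partial>?DJ) = m" .
      have ei: "integrable ?DJ (\<lambda>y. exp (Z y))"
      proof (rule DJ.integrable_const_bound[where B = "exp \<bar>t\<bar>"])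
        show "AE y in ?DJ. norm (exp (Z y)) \<le> exp \<bar>t\<bar>"
        proof (rule AE_I2)
          fix y assume y: "y \<in> space ?DJ"
          have "\<bar>\<Sum>i=1..n. H x (y (n + i)) - H x (x i)\<bar> \<le> (\<Sum>i=1..n. 1)"
          proof (rule order.trans[OF sum_abs sum_mono])
            fix i assume i: "i \<in> ?I"
            have "y (n + i) \<in> space D" using y i by (auto simp: space_PiM)
            from range[OF x this] range[OF x xi[OF i]]
            show "\<bar>H x (y (n + i)) - H x (x i)\<bar> \<le> 1" by auto
          qed
          then have "\<bar>Z y\<bar> \<le> \<bar>t\<bar> / n * n"
            unfolding Z_def abs_mult abs_divide by (intro mult_mono) auto
          also have "\<bar>t\<bar> / n * n = \<bar>t\<bar>" using n by simp
          finally show "norm (exp (Z y)) \<le> exp \<bar>t\<bar>" by simp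
        qed
        show "(\<lambda>y. exp (Z y)) \<in> borel_measurable ?DJ"
          using Zi by measurable
      qed
      \<comment> \<open>Jensen's inequality through the tangent of \<open>exp\<close> at
        \<open>m\<close>: the mean of \<open>Z\<close> is \<open>m\<close>, so the tangent
        integrates to \<open>exp m\<close>.\<close>
      have "exp m = (\<integral>y. exp m * (1 + (Z y - m)) \<partial>?DJ)"
        using Zi Zm by (simp add: DJ.prob_space)
      also have "\<dots> \<le> (\<integral>y. exp (Z y) \<partial>?DJ)"
      proof (rule integral_mono)
        show "exp m * (1 + (Z y - m)) \<le> exp (Z y)" for y
        proof -
          have "exp m * (1 + (Z y - m)) \<le> exp m * exp (Z y - m)"
            by (intro mult_left_mono exp_ge_add_one_self) auto
          then show ?thesis by (simp flip: exp_add)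
        qed
      qed (use Zi ei in auto)
      finally have "ennreal (exp m) \<le> ennreal (\<integral>y. exp (Z y) \<partial>?DJ)"
        by (rule ennreal_leI)
      also have "\<dots> = (\<integral>\<^sup>+ y. ennreal (exp (Z y)) \<partial>?DJ)"
        using ei by (intro nn_integral_eq_integral[symmetric]) auto
      finally show ?thesis
        unfolding \<Psi>Z m_def .
    qed
    ultimately show ?thesis
      by (simp add: nn_integral_mono)
  qed
  also have "\<dots> \<le> ennreal (N * exp (t\<^sup>2 / (2 * real n)))"
  proof -
    \<comment> \<open>Exchanging the points i and n + i for all i in \<sigma> leaves the law of the double sample
      invariant.\<close>
    define \<pi> where "\<pi> = (\<lambda>\<sigma> k. if k \<in> \<sigma> then n + k else if k > n \<and> k - n \<in> \<sigma> then k - n else k)"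
    define sw where "sw = (\<lambda>\<sigma> (\<omega> :: nat \<Rightarrow> 'z). \<lambda>k\<in>?K. \<omega> (\<pi> \<sigma> k))"
    have \<pi>K: "\<pi> \<sigma> k \<in> ?K" if "\<sigma> \<subseteq> ?I" "k \<in> ?K" for \<sigma> k
      using that unfolding \<pi>_def by auto
    have sw_distr: "distr ?DK ?DK (sw \<sigma>) = ?DK" if \<sigma>: "\<sigma> \<subseteq> ?I" for \<sigma>
    proof -
      \<comment> \<open>Since \<sigma> lies in the lower half, \<open>\<pi> \<sigma>\<close> is an
        involution. Injectivity is what invariance of the product measure under reindexing asks
        for.\<close>
      have "inj_on (\<pi> \<sigma>) ?K"
      proof (rule inj_onI)
        fix k l assume *: "k \<in> ?K" "l \<in> ?K" "\<pi> \<sigma> k = \<pi> \<sigma> l"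
        have le: "1 \<le> k \<and> k \<le> n" if "k \<in> \<sigma>" for k
          using \<sigma> that by auto
        have up: "\<pi> \<sigma> k = n + k \<and> \<pi> \<sigma> (n + k) = k" if k: "k \<in> \<sigma>" for k
        proof -
          have "n + k \<notin> \<sigma>"
          proof
            assume "n + k \<in> \<sigma>"
            from le[OF this] le[OF k] show False by simp
          qed
          then show ?thesis using k le[OF k] unfolding \<pi>_def by simp
        qed
        have inv: "\<pi> \<sigma> (\<pi> \<sigma> k) = k" for k
        proof -
          consider "k \<in> \<sigma>" | l where "l \<in> \<sigma>" "k = n + l" | "\<pi> \<sigma> k = k"
            unfolding \<pi>_def by (metis le_add_diff_inverse less_imp_le_nat)
          then show ?thesis by cases (simp_all add: up)
        qed
        show "k = l" using arg_cong[OF *(3), of "\<pi> \<sigma>"] unfolding inv .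
      qed
      then show ?thesis
        unfolding sw_def using \<pi>K[OF \<sigma>] by (intro distr_PiM_reindex D Pi_I)
    qed
    have sw_m[measurable]: "sw \<sigma> \<in> ?DK \<rightarrow>\<^sub>M ?DK" if "\<sigma> \<subseteq> ?I" for \<sigma>
      unfolding sw_def using \<pi>K[OF that] by (intro measurable_restrict measurable_component_singleton)
    have inv: "(\<integral>\<^sup>+ \<omega>. ennreal (\<Psi> \<omega>) \<partial>?DK) = (\<integral>\<^sup>+ \<omega>. ennreal (\<Psi> (sw \<sigma> \<omega>)) \<partial>?DK)"
      if \<sigma>: "\<sigma> \<subseteq> ?I" for \<sigma>
      using nn_integral_distr[OF sw_m[OF \<sigma>], of "\<lambda>\<omega>. ennreal (\<Psi> \<omega>)"] \<Psi> sw_distr[OF \<sigma>] by simp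
    have ptwise: "(\<Sum>\<sigma>\<in>Pow ?I. \<Psi> (sw \<sigma> \<omega>)) \<le> 2 ^ n * (N * exp (t\<^sup>2 / (2 * real n)))"
      if \<omega>: "\<omega> \<in> space ?DK" for \<omega>
    proof -
      define Pat where "Pat = (\<lambda>d. \<lambda>i\<in>?K. H d (\<omega> i)) ` space ?DI"
      have \<omega>': "\<omega> \<in> ?K \<rightarrow> space D" using \<omega> by (auto simp: space_PiM)
      have Pat: "finite Pat" "card Pat \<le> N"
        using patterns[OF \<omega>'] unfolding Pat_def by auto
      define a where "a = (\<lambda>p i. t / n * (p (n + i) - p i))"
      \<comment> \<open>The exchange alters the sample that selects the function, so the realized
        pattern depends on \<sigma>. Passing from this single term to the sum over all patterns
        removes the dependence and lets the two sums be interchanged.\<close>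
      have "\<Psi> (sw \<sigma> \<omega>) \<le> (\<Sum>p\<in>Pat. exp (\<Sum>i\<in>?I. if i \<in> \<sigma> then - a p i else a p i))"
        if \<sigma>: "\<sigma> \<subseteq> ?I" for \<sigma>
      proof -
        define d where "d = restrict (sw \<sigma> \<omega>) ?I"
        define p where "p = (\<lambda>i\<in>?K. H d (\<omega> i))"
        have "sw \<sigma> \<omega> \<in> space ?DK"
          using sw_m[OF \<sigma>] \<omega> by (rule measurable_space)
        then have "d \<in> space ?DI" unfolding d_def by (auto simp: space_PiM)
        then have p: "p \<in> Pat" unfolding p_def Pat_def by auto
        have "t / n * (H d (sw \<sigma> \<omega> (n + i)) - H d (sw \<sigma> \<omega> i)) = (if i \<in> \<sigma> then - a p i else a p i)"
          if i: "i \<in> ?I" for i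
        proof -
          have "\<pi> \<sigma> (n + i) = (if i \<in> \<sigma> then i else n + i)" "\<pi> \<sigma> i = (if i \<in> \<sigma> then n + i else i)"
            using i \<sigma> unfolding \<pi>_def by auto
          then show ?thesis
            using i unfolding sw_def p_def a_def by (auto simp: algebra_simps)
        qed
        then have "\<Psi> (sw \<sigma> \<omega>) = exp (\<Sum>i\<in>?I. if i \<in> \<sigma> then - a p i else a p i)"
          unfolding \<Psi>_def d_def[symmetric] by (simp add: sum_distrib_left)
        also have "\<dots> \<le> (\<Sum>p\<in>Pat. exp (\<Sum>i\<in>?I. if i \<in> \<sigma> then - a p i else a p i))"
          by (rule member_le_sum[OF p _ Pat(1)]) auto
        finally show ?thesis .
      qed
      then have "(\<Sum>\<sigma>\<in>Pow ?I. \<Psi> (sw \<sigma> \<omega>)) \<le>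
          (\<Sum>\<sigma>\<in>Pow ?I. \<Sum>p\<in>Pat. exp (\<Sum>i\<in>?I. if i \<in> \<sigma> then - a p i else a p i))"
        by (intro sum_mono) auto
      also have "\<dots> = (\<Sum>p\<in>Pat. \<Sum>\<sigma>\<in>Pow ?I. exp (\<Sum>i\<in>?I. if i \<in> \<sigma> then - a p i else a p i))"
        by (rule sum.swap)
      also have "\<dots> \<le> (\<Sum>p\<in>Pat. 2 ^ n * exp (t\<^sup>2 / (2 * real n)))"
      proof (rule sum_mono)
        fix p assume "p \<in> Pat"
        then obtain d where d: "d \<in> space ?DI" "p = (\<lambda>i\<in>?K. H d (\<omega> i))"
          unfolding Pat_def by auto
        have "(a p i)\<^sup>2 \<le> t\<^sup>2 / n\<^sup>2" if i: "i \<in> ?I" for i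
        proof -
          have "i \<in> ?K" "n + i \<in> ?K" using i by auto
          then have "\<bar>p (n + i) - p i\<bar> \<le> 1"
            using range[OF d(1), of "\<omega> i"] range[OF d(1), of "\<omega> (n + i)"] \<omega>' unfolding d(2)
            by (auto simp: Pi_iff)
          then have "(p (n + i) - p i)\<^sup>2 \<le> 1"
            by (simp add: abs_square_le_1)
          then have "(t / n)\<^sup>2 * (p (n + i) - p i)\<^sup>2 \<le> (t / n)\<^sup>2 * 1"
            by (intro mult_left_mono) auto
          then show ?thesis unfolding a_def by (simp add: power_mult_distrib power_divide)
        qed
        then have "(\<Sum>i\<in>?I. (a p i)\<^sup>2) \<le> (\<Sum>i\<in>?I. t\<^sup>2 / n\<^sup>2)"
          by (intro sum_mono)
        also have "\<dots> = t\<^sup>2 / n"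
          using n by (simp add: power2_eq_square)
        finally have "(\<Sum>i\<in>?I. (a p i)\<^sup>2) / 2 \<le> t\<^sup>2 / (2 * real n)"
          by simp
        then have le: "2 ^ n * exp ((\<Sum>i\<in>?I. (a p i)\<^sup>2) / 2) \<le> 2 ^ n * exp (t\<^sup>2 / (2 * real n))"
          by simp
        have "(\<Sum>\<sigma>\<in>Pow ?I. exp (\<Sum>i\<in>?I. if i \<in> \<sigma> then - a p i else a p i))
            \<le> 2 ^ n * exp ((\<Sum>i\<in>?I. (a p i)\<^sup>2) / 2)"
          using rademacher_exp_sum_le[of ?I "a p"] by simp
        from order.trans[OF this le] show "(\<Sum>\<sigma>\<in>Pow ?I. exp (\<Sum>i\<in>?I. if i \<in> \<sigma> then - a p i else a p i)) \<le> 2 ^ n * exp (t\<^sup>2 / (2 * real n))" .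
      qed
      also have "\<dots> = card Pat * (2 ^ n * exp (t\<^sup>2 / (2 * real n)))"
        by simp
      also have "\<dots> \<le> N * (2 ^ n * exp (t\<^sup>2 / (2 * real n)))"
        using Pat by (intro mult_right_mono) auto
      finally show ?thesis by (simp add: mult_ac)
    qed
    have two: "ennreal (2 ^ n) = of_nat (card (Pow ?I))"
      by (simp add: card_Pow ennreal_of_nat_eq_real_of_nat)
    have "ennreal (2 ^ n) * (\<integral>\<^sup>+ \<omega>. ennreal (\<Psi> \<omega>) \<partial>?DK) = (\<Sum>\<sigma>\<in>Pow ?I. (\<integral>\<^sup>+ \<omega>. ennreal (\<Psi> \<omega>) \<partial>?DK))"
      by (simp only: two sum_constant)
    also have "\<dots> = (\<Sum>\<sigma>\<in>Pow ?I. (\<integral>\<^sup>+ \<omega>. ennreal (\<Psi> (sw \<sigma> \<omega>)) \<partial>?DK))"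
      using inv by (intro sum.cong) auto
    also have "\<dots> = (\<integral>\<^sup>+ \<omega>. (\<Sum>\<sigma>\<in>Pow ?I. ennreal (\<Psi> (sw \<sigma> \<omega>))) \<partial>?DK)"
      by (rule nn_integral_sum[symmetric])
        (use measurable_compose[OF sw_m \<Psi>] in auto)
    also have "\<dots> \<le> (\<integral>\<^sup>+ \<omega>. ennreal (2 ^ n * (N * exp (t\<^sup>2 / (2 * real n)))) \<partial>?DK)"
    proof (rule nn_integral_mono)
      fix \<omega> assume \<omega>: "\<omega> \<in> space ?DK"
      have "(\<Sum>\<sigma>\<in>Pow ?I. ennreal (\<Psi> (sw \<sigma> \<omega>))) = ennreal (\<Sum>\<sigma>\<in>Pow ?I. \<Psi> (sw \<sigma> \<omega>))"
        by (rule sum_ennreal) (simp add: \<Psi>_def)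
      also have "\<dots> \<le> ennreal (2 ^ n * (N * exp (t\<^sup>2 / (2 * real n))))"
        using ptwise[OF \<omega>] by (rule ennreal_leI)
      finally show "(\<Sum>\<sigma>\<in>Pow ?I. ennreal (\<Psi> (sw \<sigma> \<omega>))) \<le> ennreal (2 ^ n * (N * exp (t\<^sup>2 / (2 * real n))))" .
    qed
    also have "\<dots> = ennreal (2 ^ n) * ennreal (N * exp (t\<^sup>2 / (2 * real n)))"
      by (simp add: DK.emeasure_space_1 ennreal_mult)
    finally show ?thesis
      by (subst (asm) ennreal_mult_le_mult_iff) auto
  qed
  finally show ?thesis .
qed

text \<open>Chernoff's method: Markov's inequality for the exponential moment. Measurability of the
  event is part of the conclusion because such events are later joined in a union bound.\<close>

lemma data_dependent_deviation_bound:
  fixes D :: "'z measure" and H :: "(nat \<Rightarrow> 'z) \<Rightarrow> 'z \<Rightarrow> real" and lo \<epsilon> :: real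
  assumes D: "prob_space D" and n: "n \<ge> 1"
    and H: "(\<lambda>(d, z). H d z) \<in> borel_measurable ((\<Pi>\<^sub>M i\<in>{1..n}. D) \<Otimes>\<^sub>M D)"
    and range: "\<And>d z. d \<in> space (\<Pi>\<^sub>M i\<in>{1..n}. D) \<Longrightarrow> z \<in> space D \<Longrightarrow> H d z \<in> {lo..lo + 1}"
    and patterns: "\<And>\<omega>. \<omega> \<in> {1..2 * n} \<rightarrow> space D \<Longrightarrow>
        finite ((\<lambda>d. \<lambda>i\<in>{1..2 * n}. H d (\<omega> i)) ` space (\<Pi>\<^sub>M i\<in>{1..n}. D)) \<and>
        card ((\<lambda>d. \<lambda>i\<in>{1..2 * n}. H d (\<omega> i)) ` space (\<Pi>\<^sub>M i\<in>{1..n}. D)) \<le> N"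
    and \<epsilon>: "\<epsilon> \<ge> 0"
  shows "{d \<in> space (\<Pi>\<^sub>M i\<in>{1..n}. D). (\<integral>z. H d z \<partial>D) - (\<Sum>i=1..n. H d (d i)) / n \<ge> \<epsilon>}
           \<in> sets (\<Pi>\<^sub>M i\<in>{1..n}. D)"
    and "\<P>(d in (\<Pi>\<^sub>M i\<in>{1..n}. D). (\<integral>z. H d z \<partial>D) - (\<Sum>i=1..n. H d (d i)) / n \<ge> \<epsilon>)
           \<le> N * exp (- (n * \<epsilon>\<^sup>2 / 2))"
proof -
  interpret D: prob_space D by fact
  let ?DI = "\<Pi>\<^sub>M i\<in>{1..n}. D"
  interpret DI: prob_space ?DI by (intro prob_space_PiM D)
  define dev where "dev = (\<lambda>d. (\<integral>z. H d z \<partial>D) - (\<Sum>i=1..n. H d (d i)) / n)"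
  have 1: "(\<lambda>d. \<integral>z. H d z \<partial>D) \<in> borel_measurable ?DI"
    using H by (rule D.borel_measurable_lebesgue_integral)
  have 2: "(\<lambda>d. H d (d i)) \<in> borel_measurable ?DI" if "i \<in> {1..n}" for i
    using measurable_compose[OF measurable_Pair[OF measurable_ident_sets[OF refl]
          measurable_component_singleton[OF that]] H] by simp
  have dev[measurable]: "dev \<in> borel_measurable ?DI"
    unfolding dev_def by (intro borel_measurable_diff borel_measurable_divide borel_measurable_sum
        borel_measurable_const 1 2) auto
  let ?A = "{d \<in> space ?DI. dev d \<ge> \<epsilon>}"
  have A: "?A \<in> sets ?DI" by measurable
  then show "{d \<in> space ?DI. (\<integral>z. H d z \<partial>D) - (\<Sum>i=1..n. H d (d i)) / n \<ge> \<epsilon>} \<in> sets ?DI"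
    unfolding dev_def .
  \<comment> \<open>The minimizer of \<open>- t * \<epsilon> + t\<^sup>2 / (2 * n)\<close>; the
    minimum is \<open>- (n * \<epsilon>\<^sup>2 / 2)\<close>.\<close>
  define t where "t = n * \<epsilon>"
  have t: "t \<ge> 0" using \<epsilon> unfolding t_def by simp
  have m: "(\<lambda>d. ennreal (exp (t * dev d))) \<in> borel_measurable ?DI"
    by measurable
  have "emeasure ?DI ?A \<le> emeasure ?DI {d \<in> space ?DI. 1 \<le> ennreal (exp (- t * \<epsilon>)) * ennreal (exp (t * dev d))}"
  proof (rule emeasure_mono)
    show "?A \<subseteq> {d \<in> space ?DI. 1 \<le> ennreal (exp (- t * \<epsilon>)) * ennreal (exp (t * dev d))}"
    proof clarsimp
      fix d assume "\<epsilon> \<le> dev d"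
      then have "0 \<le> - t * \<epsilon> + t * dev d" using t by (simp add: mult_left_mono)
      then have "1 \<le> exp (- t * \<epsilon> + t * dev d)" by simp
      then show "1 \<le> ennreal (exp (- (t * \<epsilon>))) * ennreal (exp (t * dev d))"
        by (simp add: ennreal_mult[symmetric] exp_add[symmetric])
    qed
  qed measurable
  also have "\<dots> \<le> ennreal (exp (- t * \<epsilon>)) * (\<integral>\<^sup>+ d. ennreal (exp (t * dev d)) * indicator (space ?DI) d \<partial>?DI)"
    by (intro nn_integral_Markov_inequality borel_measurable_times_ennreal borel_measurable_indicator
        sets.top m)
  also have "(\<integral>\<^sup>+ d. ennreal (exp (t * dev d)) * indicator (space ?DI) d \<partial>?DI) = (\<integral>\<^sup>+ d. ennreal (exp (t * dev d)) \<partial>?DI)"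
    by (intro nn_integral_cong) simp
  also have "\<dots> \<le> ennreal (N * exp (t\<^sup>2 / (2 * real n)))"
    using symmetrization_mgf[OF D n H range patterns, of t] by (simp add: dev_def)
  also have "ennreal (exp (- t * \<epsilon>)) * ennreal (N * exp (t\<^sup>2 / (2 * real n))) =
      ennreal (N * exp (- (n * \<epsilon>\<^sup>2 / 2)))"
  proof -
    have "- t * \<epsilon> + t\<^sup>2 / (2 * real n) = - (n * \<epsilon>\<^sup>2 / 2)"
      using n unfolding t_def by (simp add: field_simps power2_eq_square)
    then show ?thesis
      by (simp add: ennreal_mult[symmetric] mult.left_commute exp_add[symmetric])
  qed
  finally have "emeasure ?DI ?A \<le> ennreal (N * exp (- (n * \<epsilon>\<^sup>2 / 2)))"
    by (simp add: mult_left_mono)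
  then show "\<P>(d in ?DI. (\<integral>z. H d z \<partial>D) - (\<Sum>i=1..n. H d (d i)) / n \<ge> \<epsilon>) \<le> N * exp (- (n * \<epsilon>\<^sup>2 / 2))"
    unfolding DI.emeasure_eq_measure dev_def by (subst (asm) ennreal_le_iff) auto
qed

text \<open>The values on \<open>I\<close> factor through the threshold pattern by way of
  \<open>F\<close>. As \<open>F\<close> may depend on the point and on the truth value in any
  manner, group weights and negated comparisons are both covered.\<close>

lemma card_threshold_function_patterns:
  fixes c :: "'i \<Rightarrow> real" and v :: "'i \<Rightarrow> 'a \<Rightarrow> real" and F :: "'i \<Rightarrow> bool \<Rightarrow> 'b"
  assumes "finite I" "finite G"
    and H: "\<And>d i. d \<in> X \<Longrightarrow> i \<in> I \<Longrightarrow> H d i = F i (c i \<le> (\<Sum>g\<in>G. \<theta> d g * v i g))"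
  shows "finite ((\<lambda>d. \<lambda>i\<in>I. H d i) ` X)"
    and "card ((\<lambda>d. \<lambda>i\<in>I. H d i) ` X) \<le> (1 + card I) ^ card G"
proof -
  let ?R = "range (\<lambda>\<theta>. {i\<in>I. c i \<le> (\<Sum>g\<in>G. \<theta> g * v i g)})"
  let ?F = "\<lambda>p. \<lambda>i\<in>I. F i (i \<in> p)"
  have fin: "finite ?R"
    by (rule finite_subset[of _ "Pow I"]) (auto simp: assms)
  have sub: "(\<lambda>d. \<lambda>i\<in>I. H d i) ` X \<subseteq> ?F ` ?R"
  proof clarify
    fix d assume "d \<in> X"
    then have "(\<lambda>i\<in>I. H d i) = ?F {i\<in>I. c i \<le> (\<Sum>g\<in>G. \<theta> d g * v i g)}"
      by (intro restrict_ext) (simp add: H)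
    then show "(\<lambda>i\<in>I. H d i) \<in> ?F ` ?R" by blast
  qed
  show "finite ((\<lambda>d. \<lambda>i\<in>I. H d i) ` X)"
    using sub fin by (meson finite_imageI finite_subset)
  have "card ((\<lambda>d. \<lambda>i\<in>I. H d i) ` X) \<le> card (?F ` ?R)"
    by (rule card_mono[OF finite_imageI[OF fin] sub])
  also have "\<dots> \<le> card ?R"
    using fin by (rule card_image_le)
  also have "\<dots> \<le> (1 + card I) ^ card G"
    using assms(1,2) by (rule card_affine_threshold_patterns)
  finally show "card ((\<lambda>d. \<lambda>i\<in>I. H d i) ` X) \<le> (1 + card I) ^ card G" .
qed

section \<open>First-order optimality for the pinball loss\<close>

text \<open>The loss is convex in the threshold \<tau> with right derivative
  \<open>of_bool (u \<le> \<tau>) - q\<close>, and the slope at the far end of a step bounds the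
  increase along it. The companion for decreasing thresholds is the same argument for a step to the
  left.\<close>

lemma pinball_loss_increase_le:
  assumes "t > 0"
  shows "pinball_loss q (\<tau> + t) u - pinball_loss q \<tau> u \<le> t * (of_bool (u \<le> \<tau> + t) - q)"
  using assms unfolding pinball_loss_def by (auto simp: algebra_simps)

lemma pinball_loss_decrease_le:
  assumes "t > 0"
  shows "pinball_loss q (\<tau> - t) u - pinball_loss q \<tau> u \<le> t * (q - of_bool (u \<le> \<tau> - t))"
  using assms unfolding pinball_loss_def by (auto simp: algebra_simps)

lemma shifted_model_update:
  assumes "finite G" "g \<in> G"
  shows "shifted_model f G (\<theta>(g := \<theta> g + t)) x = shifted_model f G \<theta> x + t * g x"
proof -
  have "(\<Sum>h\<in>G. (\<theta>(g := \<theta> g + t)) h * h x) = (\<Sum>h\<in>G. \<theta> h * h x + (if h = g then t * g x else 0))"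
    by (intro sum.cong) (auto simp: algebra_simps)
  also have "\<dots> = (\<Sum>h\<in>G. \<theta> h * h x) + t * g x"
    using assms by (simp add: sum.distrib)
  finally show ?thesis
    unfolding shifted_model_def by simp
qed

lemma empirical_loss_diff:
  "empirical_loss n d s q f G \<theta>' - empirical_loss n d s q f G \<theta> =
     (\<Sum>i=1..n. pinball_loss q (shifted_model f G \<theta>' (fst (d i))) (s (fst (d i)) (snd (d i)))
       - pinball_loss q (shifted_model f G \<theta> (fst (d i))) (s (fst (d i)) (snd (d i)))) / n"
  unfolding empirical_loss_def by (simp add: case_prod_beta sum_subtractf diff_divide_distrib)

text \<open>The one-sided derivatives of the empirical loss at a minimizer in the direction of a group
  have a sign. Replacing a comparison by a strict one only matters for ties.\<close>

lemma empirical_minimizer_coverage: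
  assumes G: "finite G" "g \<in> G" and n: "n \<ge> 1"
    and min: "is_arg_min (empirical_loss n d s q f G) (\<lambda>\<mu>. \<mu> \<in> G \<rightarrow>\<^sub>E UNIV) \<theta>"
    and g: "\<And>i. i \<in> {1..n} \<Longrightarrow> g (fst (d i)) \<in> {0, 1}"
  shows "0 \<le> (\<Sum>i=1..n. g (fst (d i)) *
              (of_bool (s (fst (d i)) (snd (d i)) \<le> shifted_model f G \<theta> (fst (d i))) - q))"
    and "(\<Sum>i=1..n. g (fst (d i)) *
              (of_bool (s (fst (d i)) (snd (d i)) < shifted_model f G \<theta> (fst (d i))) - q)) \<le> 0"
proof -
  define u where "u = (\<lambda>i. s (fst (d i)) (snd (d i)))"
  define \<tau> where "\<tau> = (\<lambda>i. shifted_model f G \<theta> (fst (d i)))"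
  define \<gamma> where "\<gamma> = (\<lambda>i. g (fst (d i)))"
  have \<gamma>: "\<gamma> i = 0 \<or> \<gamma> i = 1" if "i \<in> {1..n}" for i
    using g[OF that] unfolding \<gamma>_def by auto
  have \<theta>: "\<theta> \<in> G \<rightarrow>\<^sub>E UNIV" using min unfolding is_arg_min_def by auto
  have min': "0 \<le> (\<Sum>i=1..n. pinball_loss q (\<tau> i + t * \<gamma> i) (u i) - pinball_loss q (\<tau> i) (u i))" for t
  proof -
    have "\<theta>(g := \<theta> g + t) \<in> G \<rightarrow>\<^sub>E UNIV" using \<theta> G by (auto simp: PiE_def extensional_def)
    then have "empirical_loss n d s q f G \<theta> \<le> empirical_loss n d s q f G (\<theta>(g := \<theta> g + t))"
      using min unfolding is_arg_min_def by (meson not_le)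
    then have "0 \<le> empirical_loss n d s q f G (\<theta>(g := \<theta> g + t)) - empirical_loss n d s q f G \<theta>"
      by simp
    then show ?thesis
      unfolding empirical_loss_diff shifted_model_update[OF G] using n
      unfolding u_def \<tau>_def \<gamma>_def by (simp add: zero_le_divide_iff)
  qed
  have right: "0 \<le> (\<Sum>i=1..n. \<gamma> i * (of_bool (u i \<le> \<tau> i + t) - q))" if t: "t > 0" for t
  proof -
    have "0 \<le> (\<Sum>i=1..n. pinball_loss q (\<tau> i + t * \<gamma> i) (u i) - pinball_loss q (\<tau> i) (u i))"
      by (rule min')
    also have "\<dots> \<le> (\<Sum>i=1..n. t * (\<gamma> i * (of_bool (u i \<le> \<tau> i + t) - q)))"
    proof (rule sum_mono)
      fix i assume "i \<in> {1..n}"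
      from \<gamma>[OF this] pinball_loss_increase_le[OF t, of q "\<tau> i" "u i"]
      show "pinball_loss q (\<tau> i + t * \<gamma> i) (u i) - pinball_loss q (\<tau> i) (u i)
          \<le> t * (\<gamma> i * (of_bool (u i \<le> \<tau> i + t) - q))" by auto
    qed
    finally show ?thesis using t by (simp add: sum_distrib_left[symmetric] zero_le_mult_iff)
  qed
  have left: "0 \<le> (\<Sum>i=1..n. \<gamma> i * (q - of_bool (u i \<le> \<tau> i - t)))" if t: "t > 0" for t
  proof -
    have "0 \<le> (\<Sum>i=1..n. pinball_loss q (\<tau> i + (- t) * \<gamma> i) (u i) - pinball_loss q (\<tau> i) (u i))"
      by (rule min')
    also have "\<dots> \<le> (\<Sum>i=1..n. t * (\<gamma> i * (q - of_bool (u i \<le> \<tau> i - t))))"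
    proof (rule sum_mono)
      fix i assume "i \<in> {1..n}"
      from \<gamma>[OF this] pinball_loss_decrease_le[OF t, of q "\<tau> i" "u i"]
      show "pinball_loss q (\<tau> i + (- t) * \<gamma> i) (u i) - pinball_loss q (\<tau> i) (u i)
          \<le> t * (\<gamma> i * (q - of_bool (u i \<le> \<tau> i - t)))" by auto
    qed
    finally show ?thesis using t by (simp add: sum_distrib_left[symmetric] zero_le_mult_iff)
  qed
  \<comment> \<open>There are finitely many sample points, so a single small step \<open>t\<close>
    serves all of them. This replaces the passage to the limit in the difference quotients.\<close>
  have small: "\<exists>t>0. \<forall>i\<in>{1..n}. P i t"
    if "\<And>i. i \<in> {1..n} \<Longrightarrow> \<forall>\<^sub>F t in at_right 0. P i t" for P :: "nat \<Rightarrow> real \<Rightarrow> bool"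
  proof -
    have "\<forall>\<^sub>F t in at_right 0. \<forall>i\<in>{1..n}. P i t"
      using that by (intro eventually_ball_finite) auto
    moreover have "\<forall>\<^sub>F t in at_right (0 :: real). t > 0"
      by (rule eventually_at_right_less)
    ultimately have "\<forall>\<^sub>F t in at_right 0. t > 0 \<and> (\<forall>i\<in>{1..n}. P i t)"
      by eventually_elim auto
    then show ?thesis
      using eventually_happens'[OF trivial_limit_at_right_real] by blast
  qed
  have "\<exists>t>0. \<forall>i\<in>{1..n}. u i \<le> \<tau> i + t \<longleftrightarrow> u i \<le> \<tau> i"
  proof (rule small)
    fix i
    show "\<forall>\<^sub>F t in at_right 0. u i \<le> \<tau> i + t \<longleftrightarrow> u i \<le> \<tau> i"
      by (rule eventually_at_rightI[of 0 "if u i \<le> \<tau> i then 1 else u i - \<tau> i"])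
        (auto split: if_splits)
  qed
  then obtain t where "t > 0" "\<forall>i\<in>{1..n}. u i \<le> \<tau> i + t \<longleftrightarrow> u i \<le> \<tau> i" by blast
  with right[of t] have "0 \<le> (\<Sum>i=1..n. \<gamma> i * (of_bool (u i \<le> \<tau> i) - q))" by simp
  then show "0 \<le> (\<Sum>i=1..n. g (fst (d i)) *
      (of_bool (s (fst (d i)) (snd (d i)) \<le> shifted_model f G \<theta> (fst (d i))) - q))"
    unfolding u_def \<tau>_def \<gamma>_def .
  \<comment> \<open>A tie \<open>u i = \<tau> i\<close> is lost by every step to the left, however
    small; hence the strict comparison on this side.\<close>
  have "\<exists>t>0. \<forall>i\<in>{1..n}. u i \<le> \<tau> i - t \<longleftrightarrow> u i < \<tau> i"
  proof (rule small)
    fix i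
    show "\<forall>\<^sub>F t in at_right 0. u i \<le> \<tau> i - t \<longleftrightarrow> u i < \<tau> i"
      by (rule eventually_at_rightI[of 0 "if u i < \<tau> i then \<tau> i - u i else 1"])
        (auto split: if_splits)
  qed
  then obtain t where "t > 0" "\<forall>i\<in>{1..n}. u i \<le> \<tau> i - t \<longleftrightarrow> u i < \<tau> i" by blast
  with left[of t] have "0 \<le> (\<Sum>i=1..n. \<gamma> i * (q - of_bool (u i < \<tau> i)))" by simp
  also have "\<dots> = - (\<Sum>i=1..n. \<gamma> i * (of_bool (u i < \<tau> i) - q))"
    by (simp add: sum_negf[symmetric] algebra_simps)
  finally show "(\<Sum>i=1..n. g (fst (d i)) *
      (of_bool (s (fst (d i)) (snd (d i)) < shifted_model f G \<theta> (fst (d i))) - q)) \<le> 0"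
    unfolding u_def \<tau>_def \<gamma>_def by simp
qed

section \<open>Disintegration of the score distribution\<close>

text \<open>The definition of \<open>K\<close> speaks of rectangles only, and rectangles generate
  the product and are closed under intersection. The extension is needed for the graph of a model,
  which is the set of ties.\<close>

lemma emeasure_disintegration:
  assumes K: "is_cond_score_distr MX S K"
    and S: "prob_space S" "sets S = sets (MX \<Otimes>\<^sub>M borel)"
    and X: "X \<in> sets S"
  shows "emeasure S X = (\<integral>\<^sup>+ x. emeasure (K x) (Pair x -` X) \<partial>distr S MX fst)"
proof -
  interpret S: prob_space S by fact
  let ?N = "MX \<Otimes>\<^sub>M (borel :: real measure)"
  define \<mu> where "\<mu> = distr S MX fst"
  have K_m: "K \<in> MX \<rightarrow>\<^sub>M subprob_algebra borel"
    using K unfolding is_cond_score_distr_def by (auto intro: measurable_prob_algebraD)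
  have K_sets: "sets (K x) = sets borel" if "x \<in> space MX" for x
    using measurable_space[OF K_m that] by (simp add: space_subprob_algebra)
  have fst_m: "fst \<in> S \<rightarrow>\<^sub>M MX"
    by (simp add: measurable_cong_sets[OF S(2) refl])
  have spS: "space S = space MX \<times> UNIV"
    using sets_eq_imp_space_eq[OF S(2)] by (simp add: space_pair_measure)
  have \<mu>: "sets \<mu> = sets MX" "space \<mu> = space MX" unfolding \<mu>_def by auto
  have ne: "space \<mu> \<noteq> {}" using S.not_empty spS \<mu> by auto
  \<comment> \<open>The law of the pair of \<open>x\<close> and its score for fixed
    \<open>x\<close>. Binding it with \<mu> gives a measure on the product, to which uniqueness of
    measures applies.\<close>
  define kern where "kern = (\<lambda>x. distr (K x) ?N (Pair x))"
  have "kern \<in> MX \<rightarrow>\<^sub>M subprob_algebra ?N"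
    unfolding kern_def by (rule measurable_distr2[OF _ K_m]) simp
  then have kern: "kern \<in> \<mu> \<rightarrow>\<^sub>M subprob_algebra ?N"
    by (simp add: measurable_cong_sets[OF \<mu>(1) refl])
  have kern_eq: "emeasure (kern x) X = emeasure (K x) (Pair x -` X)"
    if "x \<in> space MX" "X \<in> sets ?N" for x X
  proof -
    have "Pair x \<in> K x \<rightarrow>\<^sub>M ?N"
      using measurable_Pair1'[OF that(1), of borel] by (simp add: measurable_cong_sets[OF K_sets[OF that(1)] refl])
    then show ?thesis
      unfolding kern_def using that K_sets[OF that(1)]
      by (simp add: emeasure_distr sets_eq_imp_space_eq[of "K x" borel])
  qed
  have bind_eq: "emeasure (\<mu> \<bind> kern) X = (\<integral>\<^sup>+ x. emeasure (K x) (Pair x -` X) \<partial>\<mu>)"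
    if "X \<in> sets ?N" for X
    unfolding emeasure_bind[OF ne kern that] using that by (intro nn_integral_cong kern_eq) (simp_all add: \<mu>)
  \<comment> \<open>The whole space is itself a rectangle of finite mass, so a constant sequence
    serves as the exhausting cover.\<close>
  have "S = \<mu> \<bind> kern"
  proof (rule measure_eqI_generator_eq[OF Int_stable_pair_measure_generator[of MX borel], where \<Omega> = "space S"
        and A = "\<lambda>_. space S"])
    show "{a \<times> b |a b. a \<in> sets MX \<and> b \<in> sets borel} \<subseteq> Pow (space S)"
      unfolding spS using sets.sets_into_space by fastforce
    show "sets S = sigma_sets (space S) {a \<times> b |a b. a \<in> sets MX \<and> b \<in> sets borel}"
      unfolding S(2) spS by (simp add: sets_pair_measure)
    show "sets (\<mu> \<bind> kern) = sigma_sets (space S) {a \<times> b |a b. a \<in> sets MX \<and> b \<in> sets borel}"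
      using sets_bind[OF sets_kernel[OF kern] ne] unfolding spS by (simp add: sets_pair_measure)
    show "range (\<lambda>_. space S) \<subseteq> {a \<times> b |a b. a \<in> sets MX \<and> b \<in> sets borel}"
      unfolding spS
      by (rule image_subsetI, rule CollectI, rule exI[of _ "space MX"], rule exI[of _ UNIV]) simp
    show "emeasure S (space S) \<noteq> \<infinity>" for i :: nat by simp
    fix X assume "X \<in> {a \<times> b |a b. a \<in> sets MX \<and> b \<in> sets (borel :: real measure)}"
    then obtain A B where AB: "X = A \<times> B" "A \<in> sets MX" "B \<in> sets (borel :: real measure)" by auto
    then have "emeasure (\<mu> \<bind> kern) X = (\<integral>\<^sup>+ x. emeasure (K x) (Pair x -` X) \<partial>\<mu>)"
      by (intro bind_eq) auto
    also have "\<dots> = (\<integral>\<^sup>+ x\<in>A. emeasure (K x) B \<partial>\<mu>)"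
      by (intro nn_integral_cong) (auto simp: AB indicator_def)
    also have "\<dots> = emeasure S X"
      using K AB unfolding is_cond_score_distr_def \<mu>_def by auto
    finally show "emeasure S X = emeasure (\<mu> \<bind> kern) X" ..
  qed auto
  then show ?thesis
    using bind_eq[of X] X S(2) unfolding \<mu>_def by simp
qed

section \<open>The constants of the bound\<close>

text \<open>The left side is a union bound over two events for each of \<open>m\<close> groups. The
  exponent equals \<open>36 * C\<close>, of which \<open>2 * C\<close> is kept, and
  \<open>exp (- (2 * C))\<close> is \<open>1 / (Y * X)\<^sup>2\<close>. One factor \<open>X\<close>
  absorbs the pattern count and the other one absorbs \<open>m\<close>. What remains is
  \<open>2 / Y\<^sup>2\<close>, which is at most \<open>\<delta>\<close> since \<open>pi > 3\<close>
  gives \<open>Y \<ge> 3 / \<delta>\<close>.\<close>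

lemma exceptional_probability_le:
  fixes \<delta> :: real and n m :: nat
  assumes \<delta>: "\<delta> \<in> {0<..<1}" and n: "n \<ge> 1"
  defines "C \<equiv> ln (pi\<^sup>2 / (3 * \<delta>)) + m * ln (1 + 2 * real n)"
  shows "2 * real m * ((1 + 2 * real n) ^ m * exp (- (n * (12 * sqrt (C / (2 * real n)))\<^sup>2 / 2))) \<le> \<delta>"
    and "0 \<le> C"
proof -
  define X where "X = (1 + 2 * real n) ^ m"
  define Y where "Y = pi\<^sup>2 / (3 * \<delta>)"
  have "3 * 3 \<le> pi * pi" using pi_gt3 by (intro mult_mono) auto
  then have Y: "3 / \<delta> \<le> Y"
    using \<delta> unfolding Y_def by (simp add: field_simps power2_eq_square)
  have "3 \<le> 3 / \<delta>" using \<delta> by (simp add: field_simps)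
  then have Y1: "1 \<le> Y" "0 < Y" using Y by auto
  have X1: "1 \<le> X" unfolding X_def by (rule one_le_power) auto
  have "real m \<le> 2 ^ m" by (metis less_exp less_imp_le of_nat_le_iff of_nat_numeral of_nat_power)
  also have "\<dots> \<le> X" unfolding X_def using n by (intro power_mono) auto
  finally have mX: "real m \<le> X" .
  have C: "C = ln (Y * X)"
    using Y1 X1 unfolding C_def Y_def[symmetric] by (simp add: ln_mult X_def ln_realpow)
  have "1 * 1 \<le> Y * X" using Y1 X1 by (intro mult_mono) auto
  then show C0: "0 \<le> C" unfolding C by simp
  have "n * (12 * sqrt (C / (2 * real n)))\<^sup>2 / 2 = 36 * C"
    using n C0 by (simp add: power_mult_distrib)
  then have "exp (- (n * (12 * sqrt (C / (2 * real n)))\<^sup>2 / 2)) \<le> exp (- (2 * C))"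
    using C0 by simp
  also have "exp (- (2 * C)) = 1 / (Y * X)\<^sup>2"
    using Y1 X1 unfolding C by (simp add: exp_minus exp_double inverse_eq_divide power2_eq_square)
  finally have e: "exp (- (n * (12 * sqrt (C / (2 * real n)))\<^sup>2 / 2)) \<le> 1 / (Y * X)\<^sup>2" .
  have "2 * real m * (X * exp (- (n * (12 * sqrt (C / (2 * real n)))\<^sup>2 / 2))) \<le> 2 * X * (X * (1 / (Y * X)\<^sup>2))"
    using mX X1 e by (intro mult_mono mult_nonneg_nonneg) auto
  also have "\<dots> = 2 / Y\<^sup>2"
    using X1 Y1 by (simp add: field_simps power2_eq_square)
  also have "\<dots> \<le> 2 / (3 / \<delta>)\<^sup>2"
    using Y Y1 \<delta> by (intro divide_left_mono power_mono mult_pos_pos zero_less_power) auto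
  also have "\<dots> = \<delta> * (2 * \<delta> / 9)"
    by (simp add: power2_eq_square)
  also have "\<dots> \<le> \<delta> * 1"
    using \<delta> by (intro mult_left_mono) auto
  finally show "2 * real m * ((1 + 2 * real n) ^ m * exp (- (n * (12 * sqrt (C / (2 * real n)))\<^sup>2 / 2))) \<le> \<delta>"
    unfolding X_def by simp
qed

text \<open>The constant 12 is 24 times 1/2, the least value of \<open>max q (1 - q)\<close>. The
  right side grows with \<open>b\<close>, both as a factor and inside the logarithm. So a level free
  of \<open>b\<close> stays below it even where \<open>b\<close> depends on the sample.\<close>

lemma alpha_bound_ge:
  fixes \<delta> \<rho> b q :: real and n m :: nat
  assumes "\<delta> \<in> {0<..<1}" "n \<ge> 1" "\<rho> \<ge> 1" "b \<ge> 1"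
  shows "12 * sqrt ((ln (pi\<^sup>2 / (3 * \<delta>)) + m * ln (1 + 2 * real n)) / (2 * real n)) \<le> alpha_bound \<rho> b q \<delta> m n"
proof -
  have "1 * (1 * (1 / 2)) \<le> \<rho> * (b * max q (1 - q))"
    using assms by (intro mult_mono) (auto simp: max_def)
  then have 1: "12 \<le> 24 * \<rho> * b * max q (1 - q)" by (simp add: mult.assoc)
  have "pi\<^sup>2 * 1 \<le> pi\<^sup>2 * b\<^sup>2" using assms by (intro mult_left_mono one_le_power) auto
  then have "pi\<^sup>2 / (3 * \<delta>) \<le> pi\<^sup>2 * b\<^sup>2 / (3 * \<delta>)"
    using assms by (intro divide_right_mono) auto
  then have "ln (pi\<^sup>2 / (3 * \<delta>)) \<le> ln (pi\<^sup>2 * b\<^sup>2 / (3 * \<delta>))"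
    using assms by (intro ln_mono) auto
  then have 2: "(ln (pi\<^sup>2 / (3 * \<delta>)) + m * ln (1 + 2 * real n)) / (2 * real n)
      \<le> (ln (pi\<^sup>2 * b\<^sup>2 / (3 * \<delta>)) + m * ln (1 + 2 * real n)) / (2 * real n)"
    by (intro divide_right_mono add_right_mono) auto
  have "0 \<le> (ln (pi\<^sup>2 / (3 * \<delta>)) + m * ln (1 + 2 * real n)) / (2 * real n)"
    using exceptional_probability_le(2)[OF assms(1,2), of m] by simp
  then show ?thesis
    unfolding alpha_bound_def using 1 2 by (intro mult_mono real_sqrt_le_mono) auto
qed

section \<open>Group coverage of the empirical minimizer\<close>

theorem theoremB3:
  fixes MX :: "'x measure" and MY :: "'y measure" and D :: "('x \<times> 'y) measure"
    and s :: "'x \<Rightarrow> 'y \<Rightarrow> real" and K :: "'x \<Rightarrow> real measure"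
    and f :: "'x \<Rightarrow> real" and G :: "('x \<Rightarrow> real) set"
    and q \<delta> \<rho> :: real and n :: nat
    and \<theta>_pop :: "('x \<Rightarrow> real) \<Rightarrow> real"
    and \<theta>_emp :: "(nat \<Rightarrow> 'x \<times> 'y) \<Rightarrow> ('x \<Rightarrow> real) \<Rightarrow> real"
  assumes D: "prob_space D" "sets D = sets (MX \<Otimes>\<^sub>M MY)"
    and score_measurable: "(\<lambda>(x, y). s x y) \<in> borel_measurable (MX \<Otimes>\<^sub>M MY)"
    and score_range: "\<And>x y. x \<in> space MX \<Longrightarrow> y \<in> space MY \<Longrightarrow> s x y \<in> {0..1}"
    and cond_distr: "is_cond_score_distr MX (score_distr MX D s) K"
    and cond_cdf_continuous: "\<And>x. x \<in> space MX \<Longrightarrow> continuous_on UNIV (cdf (K x))"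
    and lipschitz: "lipschitz_scores MX K \<rho>"
    and f: "f \<in> borel_measurable MX" "f \<in> space MX \<rightarrow> {0..1}"
    and G: "finite G" "G \<subseteq> borel_measurable MX" "G \<subseteq> space MX \<rightarrow>\<^sub>E {0, 1}"
    and group_pos: "\<And>g. g \<in> G \<Longrightarrow> 0 < \<P>((x, y) in D. g x = 1)"
    and q: "q \<in> {0..1}" and \<delta>: "\<delta> \<in> {0<..<1}" and n: "n \<ge> 1"
    and \<theta>_pop: "is_arg_min (population_loss D s q f G) (\<lambda>\<mu>. \<mu> \<in> G \<rightarrow>\<^sub>E UNIV) \<theta>_pop"
    and \<theta>_emp: "\<And>d. d \<in> space (\<Pi>\<^sub>M i\<in>{1..n}. D) \<Longrightarrow>
        is_arg_min (empirical_loss n d s q f G) (\<lambda>\<mu>. \<mu> \<in> G \<rightarrow>\<^sub>E UNIV) (\<theta>_emp d)"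
    and \<theta>_emp_measurable: "\<theta>_emp \<in> (\<Pi>\<^sub>M i\<in>{1..n}. D) \<rightarrow>\<^sub>M (\<Pi>\<^sub>M g\<in>G. borel)"
  shows "\<P>(d in (\<Pi>\<^sub>M i\<in>{1..n}. D). \<forall>g\<in>G.
           \<bar>\<P>((x, y) in D. y \<in> prediction_set MY s (shifted_model f G (\<theta>_emp d)) x \<bar> g x = 1) - q\<bar>
             \<le> sqrt (alpha_bound \<rho> (norm_bound G \<theta>_pop (\<theta>_emp d)) q \<delta> (card G) n
                      / \<P>((x, y) in D. g x = 1)))
         \<ge> 1 - \<delta>"
proof -
  interpret D: prob_space D by (rule D(1))
  let ?DI = "\<Pi>\<^sub>M i\<in>{1..n}. D"
  interpret DI: prob_space ?DI by (intro prob_space_PiM D(1))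
  define sc where "sc = (\<lambda>z. s (fst z) (snd z))"
  define \<tau> where "\<tau> = (\<lambda>d (z :: 'x \<times> 'y). shifted_model f G (\<theta>_emp d) (fst z))"
  have D_cong: "(h \<in> D \<rightarrow>\<^sub>M N) = (h \<in> MX \<Otimes>\<^sub>M MY \<rightarrow>\<^sub>M N)" for h and N :: "real measure"
    by (simp only: measurable_cong_sets[OF D(2) refl])
  have fst_m: "fst \<in> D \<rightarrow>\<^sub>M MX"
    by (simp add: measurable_cong_sets[OF D(2) refl])
  have spD: "space D = space MX \<times> space MY"
    using sets_eq_imp_space_eq[OF D(2)] by (simp add: space_pair_measure)
  have sc_m: "sc \<in> borel_measurable D"
    using score_measurable unfolding D_cong sc_def by (simp add: case_prod_beta')
  have f_m: "(\<lambda>z. f (fst z)) \<in> borel_measurable D"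
    using fst_m f(1) by (rule measurable_compose)
  have g_m: "(\<lambda>z. g (fst z)) \<in> borel_measurable D" if "g \<in> G" for g
    using fst_m by (rule measurable_compose) (use G(2) that in auto)
  have g01: "g (fst z) = 0 \<or> g (fst z) = 1" if "g \<in> G" "z \<in> space D" for g z
  proof -
    have "g \<in> space MX \<rightarrow>\<^sub>E {0, 1}" using G(3) that(1) by (rule subsetD)
    moreover have "fst z \<in> space MX" using that(2) unfolding spD by auto
    ultimately have "g (fst z) \<in> {0, 1}" by (rule PiE_mem)
    then show ?thesis by simp
  qed
  have \<theta>_m: "(\<lambda>d. \<theta>_emp d g) \<in> borel_measurable ?DI" if "g \<in> G" for g
    using \<theta>_emp_measurable measurable_component_singleton[OF that] by (rule measurable_compose)
  have \<tau>_m: "(\<lambda>p. \<tau> (fst p) (snd p)) \<in> borel_measurable (?DI \<Otimes>\<^sub>M D)"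
    unfolding \<tau>_def shifted_model_def
    by (intro borel_measurable_add borel_measurable_sum borel_measurable_times
        measurable_compose[OF measurable_snd f_m] measurable_compose[OF measurable_snd g_m]
        measurable_compose[OF measurable_fst \<theta>_m])
  have sc_m2: "(\<lambda>p. sc (snd p)) \<in> borel_measurable (?DI \<Otimes>\<^sub>M D)"
    by (rule measurable_compose[OF measurable_snd sc_m])

  \<comment> \<open>The Lipschitz condition between 0 and 1 sees only the mass of the half-open
    interval, as the cdf at 0 includes the point 0. Continuity of the cdf rules out an atom
    there.\<close>
  have \<rho>: "\<rho> \<ge> 1"
  proof -
    obtain x where x: "x \<in> space MX" using D.not_empty spD by auto
    have K_m: "K \<in> MX \<rightarrow>\<^sub>M prob_algebra borel" and K1: "emeasure (K x) {0..1} = 1"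
      using cond_distr x unfolding is_cond_score_distr_def by auto
    have Kx: "prob_space (K x)" "sets (K x) = sets borel"
      using measurable_space[OF K_m x] by (auto simp: space_prob_algebra)
    then interpret Kx: real_distribution "K x"
      by (simp add: real_distribution_def real_distribution_axioms_def)
    have m01: "measure (K x) {0..1} = 1" using K1 by (simp add: measure_def)
    have "measure (K x) {0} = 0"
      using cond_cdf_continuous[OF x] Kx.isCont_cdf by (simp add: continuous_on_eq_continuous_at)
    moreover have "measure (K x) ({0<..1}) = measure (K x) {0..1} - measure (K x) {0}"
    proof -
      have "{0<..1} = {0..1} - {0 :: real}" by auto
      then show ?thesis by (simp add: Kx.finite_measure_Diff)
    qed
    ultimately have "measure (K x) {0<..1} = 1" using m01 by simp
    moreover have "cdf (K x) 1 - cdf (K x) 0 = measure (K x) {0<..1}"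
      using Kx.cdf_diff_eq[of 0 1] by simp
    moreover have "cdf (K x) 1 - cdf (K x) 0 \<le> \<rho> * (1 - 0)"
      using lipschitz[unfolded lipschitz_scores_def, rule_format, OF x, of 0 1] by simp
    ultimately show ?thesis by simp
  qed

  \<comment> \<open>For a fixed sample \<open>d\<close> the fitted model is a fixed function
    \<open>h\<close> and the ties form its graph. The section of the graph at \<open>x\<close> is
    the single point \<open>h x\<close>, which is null for \<open>K x\<close>.\<close>
  have no_tie: "AE z in D. sc z \<noteq> \<tau> d z" if d: "d \<in> space ?DI" for d
  proof -
    define S where "S = score_distr MX D s"
    define h where "h = shifted_model f G (\<theta>_emp d)"
    have h_m: "h \<in> borel_measurable MX"
      unfolding h_def shifted_model_def using f(1) G(2)
      by (intro borel_measurable_add borel_measurable_sum borel_measurable_times borel_measurable_const) auto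
    have pair_m: "(\<lambda>z. (fst z, sc z)) \<in> D \<rightarrow>\<^sub>M MX \<Otimes>\<^sub>M borel"
      by (intro measurable_Pair fst_m sc_m)
    have S_eq: "S = distr D (MX \<Otimes>\<^sub>M borel) (\<lambda>z. (fst z, sc z))"
      unfolding S_def score_distr_def sc_def by (simp add: case_prod_beta')
    have S: "prob_space S" "sets S = sets (MX \<Otimes>\<^sub>M borel)"
      unfolding S_eq using D.prob_space_distr[OF pair_m] by auto
    define X where "X = {p \<in> space (MX \<Otimes>\<^sub>M borel). snd p = h (fst p)}"
    have X: "X \<in> sets (MX \<Otimes>\<^sub>M borel)"
      unfolding X_def
      by (intro borel_measurable_eq measurable_snd measurable_compose[OF measurable_fst h_m])
    have "emeasure S X = (\<integral>\<^sup>+ x. emeasure (K x) (Pair x -` X) \<partial>distr S MX fst)"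
      using cond_distr S X unfolding S_def[symmetric] by (intro emeasure_disintegration) auto
    also have "\<dots> = (\<integral>\<^sup>+ x. 0 \<partial>distr S MX fst)"
    proof (rule nn_integral_cong)
      fix x assume "x \<in> space (distr S MX fst)"
      then have x: "x \<in> space MX" by simp
      have K_m: "K \<in> MX \<rightarrow>\<^sub>M prob_algebra borel"
        using cond_distr unfolding is_cond_score_distr_def by auto
      have Kx: "prob_space (K x)" "sets (K x) = sets borel"
        using measurable_space[OF K_m x] by (auto simp: space_prob_algebra)
      then interpret Kx: real_distribution "K x"
        by (simp add: real_distribution_def real_distribution_axioms_def)
      have "measure (K x) {h x} = 0"
        using cond_cdf_continuous[OF x] Kx.isCont_cdf by (simp add: continuous_on_eq_continuous_at)
      moreover have "Pair x -` X = {h x}"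
        using x unfolding X_def by (auto simp: space_pair_measure)
      ultimately show "emeasure (K x) (Pair x -` X) = 0"
        by (simp add: Kx.emeasure_eq_measure)
    qed
    finally have "emeasure S X = 0" by simp
    then have "emeasure D ((\<lambda>z. (fst z, sc z)) -` X \<inter> space D) = 0"
      unfolding S_eq by (simp add: emeasure_distr[OF pair_m X])
    moreover have "(\<lambda>z. (fst z, sc z)) -` X \<inter> space D = {z \<in> space D. \<not> sc z \<noteq> \<tau> d z}"
      unfolding X_def \<tau>_def h_def spD by (auto simp: space_pair_measure)
    moreover have "{z \<in> space D. \<not> sc z \<noteq> \<tau> d z} \<in> sets D"
      unfolding calculation(2)[symmetric] by (rule measurable_sets[OF pair_m X])
    ultimately show ?thesis
      by (intro AE_I[where N = "{z \<in> space D. \<not> sc z \<noteq> \<tau> d z}"]) auto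
  qed

  \<comment> \<open>The signs are chosen so that both empirical means are at most 0 at the
    minimizer. Only upper deviations of the population mean then have to be excluded. Both functions
    take values in an interval of length 1.\<close>
  define Hle where "Hle = (\<lambda>g d z. - (g (fst z) * (of_bool (sc z \<le> \<tau> d z) - q)))"
  define Hlt where "Hlt = (\<lambda>g d z. g (fst z) * (of_bool (sc z < \<tau> d z) - q))"
  have Hle_m: "(\<lambda>(d, z). Hle g d z) \<in> borel_measurable (?DI \<Otimes>\<^sub>M D)" if "g \<in> G" for g
    unfolding Hle_def case_prod_beta' of_bool_def
    by (intro borel_measurable_uminus borel_measurable_times borel_measurable_diff
        measurable_If borel_measurable_const measurable_compose[OF measurable_snd g_m[OF that]]
        borel_measurable_le sc_m2 \<tau>_m)
  have Hlt_m: "(\<lambda>(d, z). Hlt g d z) \<in> borel_measurable (?DI \<Otimes>\<^sub>M D)" if "g \<in> G" for g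
    unfolding Hlt_def case_prod_beta' of_bool_def
    by (intro borel_measurable_times borel_measurable_diff
        measurable_If borel_measurable_const measurable_compose[OF measurable_snd g_m[OF that]]
        borel_measurable_less sc_m2 \<tau>_m)
  have Hle_range: "Hle g d z \<in> {q - 1..q - 1 + 1}" if "g \<in> G" "z \<in> space D" for g d z
    using g01[OF that] q unfolding Hle_def by auto
  have Hlt_range: "Hlt g d z \<in> {- q..- q + 1}" if "g \<in> G" "z \<in> space D" for g d z
    using g01[OF that] q unfolding Hlt_def by auto
  let ?N = "(1 + 2 * n) ^ card G"
  have Hle_card: "finite ((\<lambda>d. \<lambda>i\<in>{1..2 * n}. Hle g d (\<omega> i)) ` space ?DI) \<and>
      card ((\<lambda>d. \<lambda>i\<in>{1..2 * n}. Hle g d (\<omega> i)) ` space ?DI) \<le> ?N" for g \<omega>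
  proof -
    have "Hle g d (\<omega> i) = (\<lambda>b. - (g (fst (\<omega> i)) * (of_bool b - q)))
        (sc (\<omega> i) - f (fst (\<omega> i)) \<le> (\<Sum>g\<in>G. \<theta>_emp d g * g (fst (\<omega> i))))" for d i
      unfolding Hle_def \<tau>_def shifted_model_def by (simp add: diff_le_eq add.commute)
    from card_threshold_function_patterns[where X = "space ?DI" and H = "\<lambda>d i. Hle g d (\<omega> i)"
        and F = "\<lambda>i b. - (g (fst (\<omega> i)) * (of_bool b - q))" and c = "\<lambda>i. sc (\<omega> i) - f (fst (\<omega> i))"
        and v = "\<lambda>i g. g (fst (\<omega> i))" and \<theta> = \<theta>_emp, OF finite_atLeastAtMost G(1) this, of 1 "2 * n"]
    show ?thesis by simp
  qed
  have Hlt_card: "finite ((\<lambda>d. \<lambda>i\<in>{1..2 * n}. Hlt g d (\<omega> i)) ` space ?DI) \<and>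
      card ((\<lambda>d. \<lambda>i\<in>{1..2 * n}. Hlt g d (\<omega> i)) ` space ?DI) \<le> ?N" for g \<omega>
  proof -
    \<comment> \<open>The pattern count is stated for non-strict comparisons. The strict one is the
      negation of a non-strict one whose features are the negated groups.\<close>
    have "(sc (\<omega> i) < \<tau> d (\<omega> i)) \<longleftrightarrow>
        \<not> (f (fst (\<omega> i)) - sc (\<omega> i) \<le> (\<Sum>g\<in>G. \<theta>_emp d g * - g (fst (\<omega> i))))" for d i
      unfolding \<tau>_def shifted_model_def by (auto simp: sum_negf)
    then have "Hlt g d (\<omega> i) = (\<lambda>b. g (fst (\<omega> i)) * (of_bool (\<not> b) - q))
        (f (fst (\<omega> i)) - sc (\<omega> i) \<le> (\<Sum>g\<in>G. \<theta>_emp d g * - g (fst (\<omega> i))))" for d i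
      unfolding Hlt_def by simp
    from card_threshold_function_patterns[where X = "space ?DI" and H = "\<lambda>d i. Hlt g d (\<omega> i)"
        and F = "\<lambda>i b. g (fst (\<omega> i)) * (of_bool (\<not> b) - q)" and c = "\<lambda>i. f (fst (\<omega> i)) - sc (\<omega> i)"
        and v = "\<lambda>i g. - g (fst (\<omega> i))" and \<theta> = \<theta>_emp, OF finite_atLeastAtMost G(1) this, of 1 "2 * n"]
    show ?thesis by simp
  qed

  \<comment> \<open>The value of alpha' when rho and b are 1 and the larger of q and 1 - q is 1/2;
    it is the same for all samples.\<close>
  define \<epsilon> where "\<epsilon> = 12 * sqrt ((ln (pi\<^sup>2 / (3 * \<delta>)) + card G * ln (1 + 2 * real n)) / (2 * real n))"
  have \<epsilon>: "\<epsilon> \<ge> 0"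
    using exceptional_probability_le(2)[OF \<delta> n, of "card G"] unfolding \<epsilon>_def by simp
  define B1 where "B1 = (\<lambda>g. {d \<in> space ?DI. (\<integral>z. Hle g d z \<partial>D) - (\<Sum>i=1..n. Hle g d (d i)) / n \<ge> \<epsilon>})"
  define B2 where "B2 = (\<lambda>g. {d \<in> space ?DI. (\<integral>z. Hlt g d z \<partial>D) - (\<Sum>i=1..n. Hlt g d (d i)) / n \<ge> \<epsilon>})"
  have B1: "B1 g \<in> sets ?DI" "measure ?DI (B1 g) \<le> ?N * exp (- (n * \<epsilon>\<^sup>2 / 2))" if "g \<in> G" for g
    unfolding B1_def
    by (rule data_dependent_deviation_bound[OF D(1) n Hle_m[OF that] Hle_range[OF that] Hle_card \<epsilon>]; assumption)+
  have B2: "B2 g \<in> sets ?DI" "measure ?DI (B2 g) \<le> ?N * exp (- (n * \<epsilon>\<^sup>2 / 2))" if "g \<in> G" for g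
    unfolding B2_def
    by (rule data_dependent_deviation_bound[OF D(1) n Hlt_m[OF that] Hlt_range[OF that] Hlt_card \<epsilon>]; assumption)+
  define B where "B = (\<Union>g\<in>G. B1 g \<union> B2 g)"
  have B_sets: "B \<in> sets ?DI"
    unfolding B_def using B1(1) B2(1) G(1) by (intro sets.finite_UN sets.Un) auto
  have "measure ?DI B \<le> (\<Sum>g\<in>G. measure ?DI (B1 g \<union> B2 g))"
    unfolding B_def using B1(1) B2(1) G(1) by (intro DI.finite_measure_subadditive_finite) auto
  also have "\<dots> \<le> (\<Sum>g\<in>G. 2 * (?N * exp (- (n * \<epsilon>\<^sup>2 / 2))))"
  proof (rule sum_mono)
    fix g assume g: "g \<in> G"
    have "measure ?DI (B1 g \<union> B2 g) \<le> measure ?DI (B1 g) + measure ?DI (B2 g)"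
      using B1(1)[OF g] B2(1)[OF g] by (rule measure_Un_le)
    then show "measure ?DI (B1 g \<union> B2 g) \<le> 2 * (?N * exp (- (n * \<epsilon>\<^sup>2 / 2)))"
      using B1(2)[OF g] B2(2)[OF g] by linarith
  qed
  also have "\<dots> = 2 * real (card G) * ((1 + 2 * real n) ^ card G * exp (- (n * \<epsilon>\<^sup>2 / 2)))"
    by simp
  also have "\<dots> \<le> \<delta>"
    unfolding \<epsilon>_def by (rule exceptional_probability_le(1)[OF \<delta> n])
  finally have B_prob: "measure ?DI B \<le> \<delta>" .

  define p where "p = (\<lambda>g :: 'x \<Rightarrow> real. \<P>((x, y) in D. g x = 1))"
  define cov where "cov = (\<lambda>(g :: 'x \<Rightarrow> real) d. \<P>((x, y) in D. y \<in> prediction_set MY s (shifted_model f G (\<theta>_emp d)) x \<bar> g x = 1))"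
  have p_eq: "p g = \<P>(z in D. case z of (x, y) \<Rightarrow> g x = 1)" for g
    unfolding p_def by (rule arg_cong[where f = "measure D"]) auto
  have p_pos: "p g > 0" if "g \<in> G" for g
    using group_pos[OF that] unfolding p_def .
  have cov_le_one: "0 \<le> cov g d" "cov g d \<le> 1" if "g \<in> G" for g d
  proof -
    have "{z \<in> space D. g (fst z) = 1} \<in> sets D"
      using g_m[OF that] by measurable
    then have "\<P>(z in D. (case z of (x, y) \<Rightarrow> y \<in> prediction_set MY s (shifted_model f G (\<theta>_emp d)) x) \<and>
        (case z of (x, y) \<Rightarrow> g x = 1)) \<le> \<P>(z in D. case z of (x, y) \<Rightarrow> g x = 1)"
      by (intro D.finite_measure_mono) (auto simp: case_prod_beta')
    then show "0 \<le> cov g d" "cov g d \<le> 1"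
      using p_pos[OF that] unfolding cov_def cond_prob_def p_eq by (auto simp: divide_le_eq_1)
  qed
  have int_le: "(\<integral>z. Hle g d z \<partial>D) = - (p g * (cov g d - q))"
    if g: "g \<in> G" and d: "d \<in> space ?DI" for g d
  proof -
    let ?A = "{z \<in> space D. sc z \<le> \<tau> d z \<and> g (fst z) = 1}" and ?A' = "{z \<in> space D. g (fst z) = 1}"
    have \<tau>d: "\<tau> d \<in> borel_measurable D"
      using measurable_compose[OF measurable_Pair1'[OF d] \<tau>_m] by simp
    have A: "?A \<in> sets D" "?A' \<in> sets D"
      using \<tau>d sc_m g_m[OF g] by measurable
    have "(\<integral>z. Hle g d z \<partial>D) = (\<integral>z. q * indicator ?A' z - indicator ?A z \<partial>D)"
      using g01[OF g] by (intro Bochner_Integration.integral_cong)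
        (force simp: Hle_def indicator_def)+
    also have "\<dots> = q * measure D ?A' - measure D ?A"
      using A by (subst Bochner_Integration.integral_diff) (auto simp: D.emeasure_eq_measure)
    also have "measure D ?A' = p g"
      unfolding p_eq by (simp add: case_prod_beta')
    also have "measure D ?A = p g * cov g d"
    proof -
      have "{z \<in> space D. (case z of (x, y) \<Rightarrow> y \<in> prediction_set MY s (shifted_model f G (\<theta>_emp d)) x) \<and>
        (case z of (x, y) \<Rightarrow> g x = 1)} = ?A"
        unfolding prediction_set_def sc_def \<tau>_def spD by auto
      then show ?thesis
        using p_pos[OF g] unfolding cov_def cond_prob_def p_eq by simp
    qed
    finally show ?thesis by (simp add: algebra_simps)
  qed
  \<comment> \<open>Off the null set of ties \<open>Hlt\<close> is the negative of
    \<open>Hle\<close>, so both deviations concern the same population quantity with opposite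
    signs.\<close>
  have int_lt: "(\<integral>z. Hlt g d z \<partial>D) = p g * (cov g d - q)"
    if g: "g \<in> G" and d: "d \<in> space ?DI" for g d
  proof -
    have Hm: "Hlt g d \<in> borel_measurable D" "Hle g d \<in> borel_measurable D"
      using measurable_compose[OF measurable_Pair1'[OF d] Hlt_m[OF g]]
        measurable_compose[OF measurable_Pair1'[OF d] Hle_m[OF g]] by simp_all
    have "(\<integral>z. Hlt g d z \<partial>D) = (\<integral>z. - Hle g d z \<partial>D)"
    proof (rule integral_cong_AE)
      show "AE z in D. Hlt g d z = - Hle g d z"
        using no_tie[OF d] by eventually_elim (auto simp: Hlt_def Hle_def)
    qed (use Hm in auto)
    then show ?thesis using int_le[OF g d] by simp
  qed
  define \<alpha> where "\<alpha> = (\<lambda>d. alpha_bound \<rho> (norm_bound G \<theta>_pop (\<theta>_emp d)) q \<delta> (card G) n)"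
  have good: "\<bar>cov g d - q\<bar> \<le> sqrt (\<alpha> d / p g)" if g: "g \<in> G" and d: "d \<in> space ?DI - B" for g d
  proof -
    have d': "d \<in> space ?DI" "d \<notin> B1 g" "d \<notin> B2 g" using d g unfolding B_def by auto
    have di: "d i \<in> space D" if "i \<in> {1..n}" for i using d'(1) that by (auto simp: space_PiM)
    have "g (fst (d i)) \<in> {0, 1}" if "i \<in> {1..n}" for i using g01[OF g di[OF that]] by auto
    note emp = empirical_minimizer_coverage[OF G(1) g n \<theta>_emp[OF d'(1)] this]
    have e1: "(\<Sum>i=1..n. Hle g d (d i)) \<le> 0"
      using emp(1) unfolding Hle_def sc_def \<tau>_def by (simp add: sum_negf)
    have e2: "(\<Sum>i=1..n. Hlt g d (d i)) \<le> 0"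
      using emp(2) unfolding Hlt_def sc_def \<tau>_def by simp
    \<comment> \<open>Avoiding \<open>B1 g\<close> limits undercoverage and avoiding
      \<open>B2 g\<close> limits overcoverage, as soon as the empirical means are known to be
      nonpositive.\<close>
    have "- (p g * (cov g d - q)) < \<epsilon> + (\<Sum>i=1..n. Hle g d (d i)) / n"
      using d' unfolding B1_def int_le[OF g d'(1), symmetric] by auto
    moreover have "p g * (cov g d - q) < \<epsilon> + (\<Sum>i=1..n. Hlt g d (d i)) / n"
      using d' unfolding B2_def int_lt[OF g d'(1), symmetric] by auto
    moreover have "(\<Sum>i=1..n. Hle g d (d i)) / n \<le> 0" "(\<Sum>i=1..n. Hlt g d (d i)) / n \<le> 0"
      using e1 e2 by (auto simp: divide_le_0_iff)
    ultimately have "\<bar>p g * (cov g d - q)\<bar> \<le> \<epsilon>" by linarith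
    also have "\<epsilon> \<le> \<alpha> d"
      unfolding \<epsilon>_def \<alpha>_def using \<delta> n \<rho> by (rule alpha_bound_ge) (simp add: norm_bound_def)
    finally have "\<bar>cov g d - q\<bar> \<le> \<alpha> d / p g"
      using p_pos[OF g] by (simp add: abs_mult pos_le_divide_eq mult.commute)
    \<comment> \<open>The coverage error is at most 1, hence at least its own square.\<close>
    moreover have "\<bar>cov g d - q\<bar> * \<bar>cov g d - q\<bar> \<le> \<bar>cov g d - q\<bar> * 1"
      using cov_le_one[OF g, of d] q by (intro mult_left_mono) auto
    ultimately show ?thesis
      by (intro real_le_rsqrt) (simp add: power2_eq_square)
  qed
  let ?E = "{d \<in> space ?DI. \<forall>g\<in>G. \<bar>cov g d - q\<bar> \<le> sqrt (\<alpha> d / p g)}"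
  \<comment> \<open>\<open>measure\<close> is 0 on sets outside the sigma-algebra, so the comparison
    with the complement of \<open>B\<close> requires \<open>?E\<close> to be measurable.\<close>
  have "?E \<in> sets ?DI"
  proof -
    have cov_m: "(\<lambda>d. cov g d) \<in> borel_measurable ?DI" if g: "g \<in> G" for g
    proof -
      \<comment> \<open>The conditional probability is rewritten as an integral over
        \<open>D\<close> with parameter \<open>d\<close>, whose measurability in \<open>d\<close> is
        that of a parameter integral.\<close>
      have "cov g d = q - (\<integral>z. Hle g d z \<partial>D) / p g" if "d \<in> space ?DI" for d
        using int_le[OF g that] p_pos[OF g] by simp
      moreover have "(\<lambda>d. q - (\<integral>z. Hle g d z \<partial>D) / p g) \<in> borel_measurable ?DI"
        by (intro borel_measurable_diff borel_measurable_divide borel_measurable_const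
            D.borel_measurable_lebesgue_integral Hle_m g)
      ultimately show ?thesis
        by (subst measurable_cong)
    qed
    have "(\<lambda>d. L2_set (\<theta>_emp d) G) \<in> borel_measurable ?DI"
      unfolding L2_set_def using \<theta>_m by measurable
    then have "\<alpha> \<in> borel_measurable ?DI"
      unfolding \<alpha>_def alpha_bound_def norm_bound_def by measurable
    then show ?thesis
      using cov_m G(1) by (intro sets.sets_Collect_finite_All borel_measurable_le) (auto intro!: borel_measurable_le)
  qed
  then have "measure ?DI (space ?DI - B) \<le> measure ?DI ?E"
    using good by (intro DI.finite_measure_mono) auto
  then have "1 - \<delta> \<le> measure ?DI ?E"
    using DI.prob_compl[OF B_sets] B_prob by simp
  then show ?thesis
    unfolding cov_def \<alpha>_def p_def .
qed

end
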